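(* Let $\mathcal{G}_{\mathrm{in}}$ be the class of all influence graphs $G=(V,E,p)$ that are in-arborescences. Then, for the influence maximization problem in the independent cascade model with full-adoption feedback, $$\sup_{G\in\mathcal{G}_{\mathrm{in}},\,k\ge 1}\frac{\mathrm{OPT}_A(G,k)}{\mathrm{OPT}_N(G,k)}\le \frac{2e}{e-1}.$$
   Context: Independent cascade (IC) model: an influence graph is a directed graph $G=(V,E,p)$ with $|V|=n$ and a probability $p_{uv}\in[0,1]$ on each edge $(u,v)\in E$. A live-edge graph (realization) $\phi$ is a random subgraph of $G$ on $V$ in which each edge $(u,v)$ is present ("live") independently with probability $p_{uv}$; $\mathcal{P}$ denotes this distribution. For $S\subseteq V$, $\Gamma(S,\phi)$ is the set of nodes reachable from $S$ in $\phi$, and $\sigma(S)=\mathbb{E}_{\Phi\sim\mathcal{P}}[|\Gamma(S,\Phi)|]$. Full-adoption feedback: when a node $u$ is selected as a seed, one observes the live/blocked status of all out-going edges of every node reachable from $u$ in the realization. A partial realization $\psi$ records the seeds selected so far together with their observed feedback; ${\rm dom}(\psi)$ is the set of seeds selected so far. An adaptive policy $\pi$ maps partial realizations to the next node to select; $V(\pi,\phi)$ is the seed set it selects under realization $\phi$, and $\sigma(\pi)=\mathbb{E}_{\Phi\sim\mathcal{P}}[|\Gamma(V(\pi,\Phi),\Phi)|]$. $\Pi(k)$ is the set of policies with $|V(\pi,\phi)|\le k$ for every realization $\phi$. $\mathrm{OPT}_N(G,k)=\max_{S\subseteq V,|S|\le k}\sigma(S)$ and $\mathrm{OPT}_A(G,k)=\sup_{\pi\in\Pi(k)}\sigma(\pi)$.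 An in-arborescence is an influence graph whose underlying graph is a directed tree with a root $r$ such that for every node $v$ the unique path between $v$ and $r$ is directed from $v$ to $r$. *)

theory Defs
  imports Complex_Main
begin

text \<open>Influence graph: finite vertex set V, edge set E \<subseteq> V \<times> V, edge probabilities p.\<close>
definition influence_graph :: "'a set \<Rightarrow> ('a \<times> 'a) set \<Rightarrow> ('a \<times> 'a \<Rightarrow> real) \<Rightarrow> bool" where
  "influence_graph V E p \<longleftrightarrow> finite V \<and> E \<subseteq> V \<times> V \<and> (\<forall>e\<in>E. 0 \<le> p e \<and> p e \<le> 1)"

text \<open>Live-edge graphs are identified with their sets of live edges (subsets of E);
  probability of a realization under the IC distribution.\<close>
definition real_prob :: "('a \<times> 'a) set \<Rightarrow> ('a \<times> 'a \<Rightarrow> real) \<Rightarrow> ('a \<times> 'a) set \<Rightarrow> real" where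
  "real_prob E p \<phi> = (\<Prod>e\<in>\<phi>. p e) * (\<Prod>e\<in>E - \<phi>. 1 - p e)"

text \<open>Nodes of V reachable from the seeds in S (within V) via live edges.\<close>
definition Gamma :: "'a set \<Rightarrow> 'a set \<Rightarrow> ('a \<times> 'a) set \<Rightarrow> 'a set" where
  "Gamma V S \<phi> = {v \<in> V. \<exists>u \<in> S \<inter> V. (u, v) \<in> \<phi>\<^sup>*}"

definition sigma :: "'a set \<Rightarrow> ('a \<times> 'a) set \<Rightarrow> ('a \<times> 'a \<Rightarrow> real) \<Rightarrow> 'a set \<Rightarrow> real" where
  "sigma V E p S = (\<Sum>\<phi>\<in>Pow E. real_prob E p \<phi> * real (card (Gamma V S \<phi>)))"

text \<open>Adaptive policies. A partial realization is (list of seeds selected so far,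
  set of observed edges, set of observed edges that are live). Under full-adoption
  feedback the observed edges are all out-going edges of nodes reachable from the seeds.
  A policy returns the next seed, or None to stop.\<close>
type_synonym 'a policy = "'a list \<Rightarrow> ('a \<times> 'a) set \<Rightarrow> ('a \<times> 'a) set \<Rightarrow> 'a option"

definition observed :: "'a set \<Rightarrow> ('a \<times> 'a) set \<Rightarrow> 'a set \<Rightarrow> ('a \<times> 'a) set \<Rightarrow> ('a \<times> 'a) set" where
  "observed V E S \<phi> = {(x, y) \<in> E. x \<in> Gamma V S \<phi>}"

fun run_policy :: "'a set \<Rightarrow> ('a \<times> 'a) set \<Rightarrow> 'a policy \<Rightarrow> ('a \<times> 'a) set \<Rightarrow> nat \<Rightarrow> 'a list" where
  "run_policy V E \<pi> \<phi> 0 = []"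
| "run_policy V E \<pi> \<phi> (Suc n) =
     (let L = run_policy V E \<pi> \<phi> n; Ob = observed V E (set L) \<phi> in
      case \<pi> L Ob (Ob \<inter> \<phi>) of None \<Rightarrow> L | Some v \<Rightarrow> L @ [v])"

text \<open>V(\<pi>, \<phi>): the set of all seeds selected by the policy under realization \<phi>.\<close>
definition policy_seeds :: "'a set \<Rightarrow> ('a \<times> 'a) set \<Rightarrow> 'a policy \<Rightarrow> ('a \<times> 'a) set \<Rightarrow> 'a set" where
  "policy_seeds V E \<pi> \<phi> = (\<Union>n. set (run_policy V E \<pi> \<phi> n))"

definition sigma_policy :: "'a set \<Rightarrow> ('a \<times> 'a) set \<Rightarrow> ('a \<times> 'a \<Rightarrow> real) \<Rightarrow> 'a policy \<Rightarrow> real" where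
  "sigma_policy V E p \<pi> =
     (\<Sum>\<phi>\<in>Pow E. real_prob E p \<phi> * real (card (Gamma V (policy_seeds V E \<pi> \<phi>) \<phi>)))"

text \<open>\<Pi>(k): policies selecting at most k seeds (nodes of V) under every realization.\<close>
definition policies_le :: "'a set \<Rightarrow> ('a \<times> 'a) set \<Rightarrow> nat \<Rightarrow> 'a policy set" where
  "policies_le V E k = {\<pi>. \<forall>\<phi> \<subseteq> E. finite (policy_seeds V E \<pi> \<phi>) \<and>
       card (policy_seeds V E \<pi> \<phi>) \<le> k \<and> policy_seeds V E \<pi> \<phi> \<subseteq> V}"

definition OPT_N :: "'a set \<Rightarrow> ('a \<times> 'a) set \<Rightarrow> ('a \<times> 'a \<Rightarrow> real) \<Rightarrow> nat \<Rightarrow> real" where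
  "OPT_N V E p k = Max {sigma V E p S | S. S \<subseteq> V \<and> card S \<le> k}"

definition OPT_A :: "'a set \<Rightarrow> ('a \<times> 'a) set \<Rightarrow> ('a \<times> 'a \<Rightarrow> real) \<Rightarrow> nat \<Rightarrow> real" where
  "OPT_A V E p k = Sup (sigma_policy V E p ` policies_le V E k)"

text \<open>In-arborescence with root r: the root has no out-going edge, every other node has
  exactly one out-going edge, and every node reaches the root along directed edges.\<close>
definition in_arborescence :: "'a set \<Rightarrow> ('a \<times> 'a) set \<Rightarrow> 'a \<Rightarrow> bool" where
  "in_arborescence V E r \<longleftrightarrow> r \<in> V \<and> E \<subseteq> V \<times> V \<and>
     (\<forall>y. (r, y) \<notin> E) \<and>
     (\<forall>v \<in> V - {r}. \<exists>!w. (v, w) \<in> E) \<and>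
     (\<forall>v \<in> V. (v, r) \<in> E\<^sup>*)"

end

theory Submission
  imports "HOL-Analysis.Henstock_Kurzweil_Integration" "HOL-Analysis.Harmonic_Numbers"
    "HOL-Analysis.Complex_Transcendental" Defs
begin

text \<open>
  Fix a policy \<open>\<pi>\<close>, a seed set \<open>S\<close> and a node \<open>w\<close>. If \<open>v\<close> is the seed of \<open>\<pi>\<close> that reaches \<open>w\<close> first,
  then no edge on the path from \<open>v\<close> to \<open>w\<close> had been observed when \<open>v\<close> was chosen; hence \<open>Y v\<close>, the
  probability of this event, is at most \<open>x v * P({v} reaches w)\<close>, where \<open>x v\<close> is the probability
  that \<open>\<pi>\<close> ever selects \<open>v\<close>. Let \<open>y v\<close> be the probability that \<open>S\<close> misses \<open>w\<close> given that the path from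
  \<open>v\<close> to \<open>w\<close> is live. The terms \<open>Y v * y v\<close> are then paid for by the marginal gains of the nodes \<open>v\<close>
  over \<open>S\<close>. For the rest, an induction up the tree shows that the set of all \<open>v\<close> with \<open>y v \<le> \<eta>\<close>
  reaches \<open>w\<close> with probability at most \<open>P(S reaches w) / (1 - sqrt \<eta>)\<close>, and integrating over
  \<open>0 \<le> \<eta> \<le> 9/16\<close> bounds the sum of \<open>Y v * (9/16 - y v)\<close> by \<open>(4 ln 2 - 3/2) P(S reaches w)\<close>.
  Together, \<open>\<sigma>(\<pi>) \<le> \<alpha> \<sigma>(S) + \<beta> (\<Sum>v. x v * (\<sigma>(S \<union> {v}) - \<sigma>(S)))\<close> with \<open>\<beta> = 16/9\<close> and
  \<open>\<alpha> = (23/18) \<beta>\<close>, so that \<open>k\<close> greedy steps yield a set \<open>S\<close> with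
  \<open>\<sigma>(S) \<ge> (1 - exp (-23/18)) / \<alpha> * \<sigma>(\<pi>)\<close>, which is enough.
\<close>

subsection \<open>Analytic inequalities\<close>

definition kap :: "real \<Rightarrow> real \<Rightarrow> real" where
  "kap e t = exp (2 * t * ln t / (t - e))"

lemma kap_deriv:
  assumes "0 \<le> e" "e < t"
  shows "(kap e has_real_derivative
     kap e t * ((2 * (t - e) - 2 * e * ln t) / (t - e)\<^sup>2)) (at t)"
  unfolding kap_def [abs_def] using assms
  by (auto intro!: derivative_eq_intros simp: field_simps power2_eq_square)

lemma exp_growth_bound:
  fixes g L :: real
  assumes "1 \<le> g" "0 \<le> L"
  shows "(exp L - 1) * (g * (1 + (g - 1) * L / 2)) \<le> exp (g * L) - 1"
proof -
  define D where "D x = exp (g * x) - 1 - (exp x - 1) * (g * (1 + (g - 1) * x / 2))" for x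
  have "D 0 \<le> D L"
  proof (rule DERIV_nonneg_imp_nondecreasing [OF assms(2)])
    fix x :: real assume x: "0 \<le> x" "x \<le> L"
    let ?d = "g * exp x * (exp ((g - 1) * x) - 1 - (g - 1) * x / 2 - (1 - exp (- x)) * (g - 1) / 2)"
    have "(D has_real_derivative g * exp (g * x) - (exp x * (g * (1 + (g - 1) * x / 2)) + (exp x - 1) * (g * ((g - 1) / 2)))) (at x)"
      unfolding D_def [abs_def] by (auto intro!: derivative_eq_intros simp: field_simps)
    moreover have "exp (g * x) = exp x * exp ((g - 1) * x)"
      by (simp add: exp_add [symmetric] algebra_simps)
    moreover have "exp x * exp (- x) = 1" by (simp add: exp_minus)
    ultimately have D: "(D has_real_derivative ?d) (at x)"
      by (simp add: algebra_simps diff_divide_distrib add_divide_distrib)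
    have "(1 - exp (- x)) * (g - 1) \<le> x * (g - 1)"
      using assms exp_ge_add_one_self [of "- x"] by (intro mult_right_mono) auto
    moreover have "1 + (g - 1) * x \<le> exp ((g - 1) * x)" by (rule exp_ge_add_one_self)
    ultimately have "0 \<le> exp ((g - 1) * x) - 1 - (g - 1) * x / 2 - (1 - exp (- x)) * (g - 1) / 2"
      by argo
    then have "0 \<le> ?d" using assms by simp
    with D show "\<exists>y. (D has_real_derivative y) (at x) \<and> 0 \<le> y" by blast
  qed
  then show ?thesis by (simp add: D_def)
qed

lemma kap_chord_mono:
  assumes "0 \<le> e" "e < s" "s \<le> t" "t < 1"
  shows "(1 - kap e s) / (1 - s\<^sup>2) \<le> (1 - kap e t) / (1 - t\<^sup>2)"
proof (rule DERIV_nonneg_imp_nondecreasing [OF assms(3)])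
  fix x assume x: "s \<le> x" "x \<le> t"
  then have xe: "e < x" and x1: "x < 1" and x0: "0 < x" using assms by auto
  have sq: "x\<^sup>2 < 1" using x0 x1 by (simp add: abs_square_less_1)
  define d where "d = (2 * (x - e) - 2 * e * ln x) / (x - e)\<^sup>2"
  define g where "g = x / (x - e)"
  define L where "L = - 2 * ln x"
  have g1: "1 \<le> g" using xe assms by (simp add: g_def)
  have L0: "0 \<le> L" using x0 x1 by (simp add: L_def)
  have "exp L = 1 / x\<^sup>2"
    using x0 by (simp add: L_def exp_minus inverse_eq_divide exp_double)
  moreover have "exp (g * L) = 1 / kap e x"
    by (simp add: g_def L_def kap_def exp_minus inverse_eq_divide)
  moreover have "g * (1 + (g - 1) * L / 2) = x * d / 2"
    using xe by (simp add: g_def L_def d_def field_simps power2_eq_square)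
  ultimately have "(1 / x\<^sup>2 - 1) * (x * d / 2) \<le> 1 / kap e x - 1"
    using exp_growth_bound [OF g1 L0] by (simp only:)
  then have "kap e x * (2 * x * ((1 / x\<^sup>2 - 1) * (x * d / 2))) \<le> kap e x * (2 * x * (1 / kap e x - 1))"
    using x0 by (intro mult_left_mono) (auto simp: kap_def)
  moreover have "kap e x * (2 * x * ((1 / x\<^sup>2 - 1) * (x * d / 2))) = kap e x * d * (1 - x\<^sup>2)"
    using x0 by (simp add: field_simps power2_eq_square)
  moreover have "kap e x * (2 * x * (1 / kap e x - 1)) = 2 * x * (1 - kap e x)"
    by (simp add: field_simps kap_def)
  ultimately have main: "kap e x * d * (1 - x\<^sup>2) \<le> 2 * x * (1 - kap e x)" by (simp only:)
  have "((\<lambda>t. (1 - kap e t) / (1 - t\<^sup>2)) has_real_derivative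
      (- (kap e x * d) * (1 - x\<^sup>2) - (1 - kap e x) * (- (2 * x))) / ((1 - x\<^sup>2) * (1 - x\<^sup>2))) (at x)"
    using sq kap_deriv [OF assms(1) xe] unfolding d_def
    by (auto intro!: derivative_eq_intros)
  moreover have "0 \<le> (- (kap e x * d) * (1 - x\<^sup>2) - (1 - kap e x) * (- (2 * x))) / ((1 - x\<^sup>2) * (1 - x\<^sup>2))"
  proof (rule divide_nonneg_nonneg)
    show "0 \<le> - (kap e x * d) * (1 - x\<^sup>2) - (1 - kap e x) * (- (2 * x))"
      using main by (simp add: algebra_simps)
  qed (rule zero_le_square)
  ultimately show "\<exists>y. ((\<lambda>t. (1 - kap e t) / (1 - t\<^sup>2)) has_real_derivative y) (at x) \<and> 0 \<le> y"
    by blast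
qed

lemma kap_le_secant:
  assumes "0 \<le> e" "e < t" "t \<le> 1"
  shows "kap e t \<le> (t\<^sup>2 - e\<^sup>2) / (1 - e\<^sup>2)"
proof -
  define h where "h x = ln (x\<^sup>2 - e\<^sup>2) - ln (1 - e\<^sup>2) - 2 * x * ln x / (x - e)" for x
  have pos: "0 < x\<^sup>2 - e\<^sup>2" if "e < x" for x
    using that assms(1) by (simp add: power_strict_mono)
  have "h 1 \<le> h t"
  proof (rule DERIV_nonpos_imp_nonincreasing [OF assms(3)])
    fix x assume x: "t \<le> x" "x \<le> 1"
    then have xe: "e < x" and x0: "0 < x" using assms by auto
    have "(h has_real_derivative (2 * x / (x\<^sup>2 - e\<^sup>2) - (2 * (x - e) - 2 * e * ln x) / (x - e)\<^sup>2)) (at x)"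
      unfolding h_def [abs_def] using xe x0 pos [OF xe]
      by (auto intro!: derivative_eq_intros simp: field_simps power2_eq_square)
    moreover have "2 * x / (x\<^sup>2 - e\<^sup>2) \<le> 2 / (x - e)"
    proof -
      have "x\<^sup>2 - e\<^sup>2 = (x - e) * (x + e)" by (simp add: power2_eq_square algebra_simps)
      then have "2 * x / (x\<^sup>2 - e\<^sup>2) = 2 / (x - e) * (x / (x + e))" by simp
      also have "\<dots> \<le> 2 / (x - e) * 1"
        using xe x0 assms(1) by (intro mult_left_mono) auto
      finally show ?thesis by simp
    qed
    moreover have "2 / (x - e) \<le> (2 * (x - e) - 2 * e * ln x) / (x - e)\<^sup>2"
    proof -
      have "e * ln x \<le> 0" using assms(1) x x0 by (simp add: mult_nonneg_nonpos)
      then have "2 * (x - e) / (x - e)\<^sup>2 \<le> (2 * (x - e) - 2 * e * ln x) / (x - e)\<^sup>2"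
        by (intro divide_right_mono) auto
      moreover have "2 * (x - e) / (x - e)\<^sup>2 = 2 / (x - e)"
        using xe by (simp add: power2_eq_square del: right_diff_distrib_numeral)
      ultimately show ?thesis by (simp only:)
    qed
    ultimately show "\<exists>y. (h has_real_derivative y) (at x) \<and> y \<le> 0" by fastforce
  qed
  then have "2 * t * ln t / (t - e) \<le> ln (t\<^sup>2 - e\<^sup>2) - ln (1 - e\<^sup>2)" by (simp add: h_def)
  then have "kap e t \<le> exp (ln (t\<^sup>2 - e\<^sup>2) - ln (1 - e\<^sup>2))" by (simp add: kap_def)
  also have "\<dots> = (t\<^sup>2 - e\<^sup>2) / (1 - e\<^sup>2)"
    using pos [OF assms(2)] pos [of 1] assms by (simp add: exp_diff)
  finally show ?thesis .
qed

text \<open>This exponent solves the differential equation \<open>- m * \<gamma>' = \<gamma> * (\<gamma> - 1) / 2\<close> with a pole at \<open>m = \<eta>\<close>,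
  which makes \<open>chain_bound\<close> tight to second order as \<open>a\<close> tends to 0.\<close>

definition gam :: "real \<Rightarrow> real \<Rightarrow> real" where
  "gam \<eta> m = sqrt m / (sqrt m - sqrt \<eta>)"

lemma powr_gam:
  assumes "0 < c" "0 \<le> \<eta>" "c * s > \<eta>"
  shows "s powr gam \<eta> (c * s) = kap (sqrt (\<eta> / c)) (sqrt s)" "sqrt (\<eta> / c) < sqrt s" "0 < s"
proof -
  show s: "0 < s" using assms by (metis le_less_trans zero_less_mult_pos)
  show "sqrt (\<eta> / c) < sqrt s" using assms by (simp add: field_simps)
  have "gam \<eta> (c * s) = sqrt s / (sqrt s - sqrt (\<eta> / c))"
  proof -
    have "gam \<eta> (c * s) = (sqrt c * sqrt s) / (sqrt c * (sqrt s - sqrt \<eta> / sqrt c))"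
      using assms by (simp add: gam_def real_sqrt_mult algebra_simps)
    then show ?thesis using assms by (simp add: real_sqrt_divide)
  qed
  then show "s powr gam \<eta> (c * s) = kap (sqrt (\<eta> / c)) (sqrt s)"
    using s by (simp add: powr_def kap_def ln_sqrt)
qed

text \<open>Effect of lengthening a branch by one edge of probability \<open>p\<close>; the second case, where nothing is
  known about \<open>R\<close>, is the one where the path below already meets the threshold.\<close>

lemma chain_bound:
  assumes \<eta>: "0 \<le> \<eta>" and p: "0 \<le> p" "p \<le> 1" and a: "0 \<le> a" "a \<le> 1" and R: "R \<le> 1"
    and m: "c * (1 - p * a) > \<eta>"
    and IH: "c * (1 - a) > \<eta> \<Longrightarrow> (1 - a) powr gam \<eta> (c * (1 - a)) \<le> 1 - R"
  shows "(1 - p * a) powr gam \<eta> (c * (1 - p * a)) \<le> 1 - p * R"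
proof -
  have pa: "p * a \<le> 1" "0 \<le> p * a" using p a by (auto simp: mult_le_one)
  have c: "0 < c" using m \<eta> pa by (metis diff_ge_0_iff_ge le_less_trans mult_nonpos_nonneg not_le)
  define e where "e = sqrt (\<eta> / c)"
  have e0: "0 \<le> e" using \<eta> c by (simp add: e_def)
  note pg = powr_gam [OF c \<eta>, folded e_def]
  define t where "t = sqrt (1 - p * a)"
  have t: "e < t" "t \<le> 1" "t\<^sup>2 = 1 - p * a" using pg(2) [OF m] pa by (auto simp: t_def)
  have goal: "(1 - p * a) powr gam \<eta> (c * (1 - p * a)) = kap e t"
    using pg(1) [OF m] by (simp add: t_def)
  show ?thesis
  proof (cases "p * a = 0")
    case True
    show ?thesis
    proof (cases "p = 0")
      case True then show ?thesis by simp
    next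
      case False
      with True have "a = 0" by simp
      with IH m have "1 \<le> 1 - R" by simp
      then show ?thesis using \<open>a = 0\<close> p by (simp add: mult_nonneg_nonpos)
    qed
  next
    case False
    with p a have p0: "0 < p" "0 < a" "0 < p * a" by (auto simp: order_less_le)
    then have t1: "t < 1" using t(2,3) by (cases "t = 1") auto
    show ?thesis
    proof (cases "c * (1 - a) > \<eta>")
      case True
      define s where "s = sqrt (1 - a)"
      have s: "e < s" "s\<^sup>2 = 1 - a" using pg(2) [OF True] a by (auto simp: s_def)
      have "a * p \<le> a * 1" using p a by (intro mult_left_mono) auto
      then have "s \<le> t" by (simp add: s_def t_def mult.commute)
      have "kap e s \<le> 1 - R" using IH [OF True] pg(1) [OF True] by (simp add: s_def)
      moreover have "(1 - kap e s) / a \<le> (1 - kap e t) / (p * a)"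
        using kap_chord_mono [OF e0 s(1) \<open>s \<le> t\<close> t1] s t by simp
      then have "p * a * ((1 - kap e s) / a) \<le> p * a * ((1 - kap e t) / (p * a))"
        using p0 by (intro mult_left_mono) auto
      then have "p * (1 - kap e s) \<le> 1 - kap e t" using p0 by simp
      moreover have "p * R \<le> p * (1 - kap e s)" using calculation(1) p by (intro mult_left_mono) auto
      ultimately show ?thesis unfolding goal by linarith
    next
      case False
      have "1 - a \<le> \<eta> / c" using False c by (simp add: field_simps)
      then have ea: "1 - e\<^sup>2 \<le> a" using \<eta> c by (simp add: e_def)
      have e1: "e\<^sup>2 < 1" using t(1) e0 t1 by (simp add: abs_square_less_1)
      have "kap e t \<le> (t\<^sup>2 - e\<^sup>2) / (1 - e\<^sup>2)" by (rule kap_le_secant [OF e0 t(1,2)])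
      also have "\<dots> = 1 - p * a / (1 - e\<^sup>2)" using e1 t(3) by (simp add: field_simps)
      also have "\<dots> \<le> 1 - p"
      proof -
        have "p * (1 - e\<^sup>2) \<le> p * a" using ea p by (intro mult_left_mono) auto
        then have "p \<le> p * a / (1 - e\<^sup>2)" using e1 by (simp add: pos_le_divide_eq)
        then show ?thesis by simp
      qed
      also have "\<dots> \<le> 1 - p * R" using R p by (simp add: mult_left_le)
      finally show ?thesis unfolding goal .
    qed
  qed
qed

lemma powr_Bernoulli:
  fixes x g :: real
  assumes "0 \<le> x" "x < 1" "1 \<le> g"
  shows "1 - g * x \<le> (1 - x) powr g"
proof -
  have "(\<lambda>x. (1 - x) powr g + g * x) 0 \<le> (\<lambda>x. (1 - x) powr g + g * x) x"
  proof (rule DERIV_nonneg_imp_nondecreasing [OF assms(1)])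
    fix y assume y: "0 \<le> y" "y \<le> x"
    then have "((\<lambda>x. (1 - x) powr g + g * x) has_real_derivative g - g * (1 - y) powr (g - 1)) (at y)"
      using assms by (auto intro!: derivative_eq_intros simp: powr_diff)
    moreover have "(1 - y) powr (g - 1) \<le> 1" using y assms by (intro powr_le1) auto
    ultimately show "\<exists>z. ((\<lambda>x. (1 - x) powr g + g * x) has_real_derivative z) (at y) \<and> 0 \<le> z"
      using assms(3) mult_left_mono [of "(1 - y) powr (g - 1)" 1 g]
      by (intro exI [of _ "g - g * (1 - y) powr (g - 1)"] conjI) simp_all
  qed
  then show ?thesis by simp
qed

lemma powr_gam_linear:
  assumes "0 \<le> \<eta>" "\<eta> < 1 - a" "0 \<le> a"
  shows "1 - (1 - a) powr gam \<eta> (1 - a) \<le> a / (1 - sqrt \<eta>)"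
proof -
  let ?R = "1 - (1 - a) powr gam \<eta> (1 - a)"
  have *: "?R \<le> gam \<eta> (1 - p * a) * a" if p: "0 < p" "p \<le> 1" for p
  proof -
    have pa: "p * a \<le> a" using p assms by (simp add: mult_left_le_one_le)
    have "(1 - p * a) powr gam \<eta> (1 * (1 - p * a)) \<le> 1 - p * ?R"
      by (rule chain_bound) (use assms p pa in auto)
    moreover have "1 - gam \<eta> (1 - p * a) * (p * a) \<le> (1 - p * a) powr gam \<eta> (1 - p * a)"
    proof -
      have g: "1 \<le> gam \<eta> (1 - p * a)" using assms pa unfolding gam_def by (subst pos_le_divide_eq) auto
      have "0 \<le> p * a" "p * a < 1" using p pa assms by simp_all
      then show ?thesis using g by (rule powr_Bernoulli)
    qed
    ultimately have "p * ?R \<le> p * (gam \<eta> (1 - p * a) * a)" by (simp add: algebra_simps)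
    then show ?thesis using p by simp
  qed
  have "((\<lambda>p. gam \<eta> (1 - p * a) * a) \<longlongrightarrow> gam \<eta> (1 - 0 * a) * a) (at_right 0)"
    unfolding gam_def using assms by (intro tendsto_intros) auto
  moreover have "eventually (\<lambda>p. ?R \<le> gam \<eta> (1 - p * a) * a) (at_right 0)"
    using eventually_at_right_real [of 0 1] by (rule eventually_mono) (use * in auto)
  ultimately have "?R \<le> gam \<eta> (1 - 0 * a) * a"
    by (intro tendsto_lowerbound) auto
  then show ?thesis by (simp add: gam_def)
qed

lemma has_integral_inverse_one_minus_sqrt:
  "((\<lambda>x. 1 / (1 - sqrt x)) has_integral (4 * ln 2 - 3 / 2)) {0..9/16::real}"
proof -
  define H where "H x = - 2 * sqrt x - 2 * ln (1 - sqrt x)" for x :: real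
  have sq: "sqrt x < 1" if "x \<le> 9/16" for x using that by simp
  have "((\<lambda>x. 1 / (1 - sqrt x)) has_integral (H (9/16) - H 0)) {0..9/16}"
  proof (rule fundamental_theorem_of_calculus_interior)
    show "continuous_on {0..9/16} H" unfolding H_def using sq by (intro continuous_intros) force
    fix x :: real assume x: "x \<in> {0<..<9/16}"
    have "(H has_real_derivative (- 2 * (inverse (sqrt x) / 2) - 2 * (- (inverse (sqrt x) / 2) / (1 - sqrt x)))) (at x)"
      unfolding H_def [abs_def] using x sq [of x] by (auto intro!: derivative_eq_intros simp: mult.commute)
    moreover have "- 2 * (inverse (sqrt x) / 2) - 2 * (- (inverse (sqrt x) / 2) / (1 - sqrt x)) = 1 / (1 - sqrt x)"
      using x sq [of x] by (simp add: field_simps)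
    ultimately show "(H has_vector_derivative 1 / (1 - sqrt x)) (at x)"
      by (simp add: has_real_derivative_iff_has_vector_derivative)
  qed simp
  moreover have "sqrt (9/16) = (3/4::real)" by (rule real_sqrt_unique) (auto simp: power2_eq_square)
  moreover have "ln (1/4::real) = - 2 * ln 2"
    using ln_realpow [of 2 2] by (simp add: ln_div)
  ultimately show ?thesis by (simp add: H_def)
qed

lemma layer_cake_bound:
  fixes Y y :: "'a \<Rightarrow> real"
  assumes "finite V" and Y: "\<And>v. v \<in> V \<Longrightarrow> 0 \<le> Y v" and y: "\<And>v. v \<in> V \<Longrightarrow> 0 \<le> y v"
    and a: "0 \<le> a"
    and le: "\<And>\<eta>. 0 \<le> \<eta> \<Longrightarrow> \<eta> < 1 \<Longrightarrow> (\<Sum>v\<in>{v\<in>V. y v \<le> \<eta>}. Y v) \<le> a / (1 - sqrt \<eta>)"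
  shows "(\<Sum>v\<in>V. Y v * (9/16 - y v)) \<le> a * (23 / 18)"
proof -
  have int: "((\<lambda>x. if y v \<le> x then Y v else 0) has_integral (Y v * max 0 (9/16 - y v))) {0..9/16}"
    if v: "v \<in> V" for v
  proof (cases "y v \<le> 9/16")
    case True
    have "((\<lambda>_. Y v) has_integral ((9/16 - y v) * Y v)) {y v..9/16}"
      using has_integral_const_real [of "Y v" "y v" "9/16"] True by simp
    then have "((\<lambda>x. if x \<in> {y v..9/16} then Y v else 0) has_integral ((9/16 - y v) * Y v)) {0..9/16}"
      using y [OF v] by (subst has_integral_restrict) auto
    then have "((\<lambda>x. if y v \<le> x then Y v else 0) has_integral ((9/16 - y v) * Y v)) {0..9/16}"
      by (rule has_integral_eq [rotated]) auto
    then show ?thesis using True by (simp add: mult.commute)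
  next
    case False
    then show ?thesis by (intro has_integral_is_0 [THEN has_integral_eq_rhs]) auto
  qed
  have "(\<Sum>v\<in>V. Y v * (9/16 - y v)) \<le> (\<Sum>v\<in>V. Y v * max 0 (9/16 - y v))"
    by (intro sum_mono mult_left_mono) (auto simp: Y)
  also have "\<dots> \<le> a * (4 * ln 2 - 3 / 2)"
  proof (rule has_integral_le)
    show "((\<lambda>x. \<Sum>v\<in>V. if y v \<le> x then Y v else 0) has_integral (\<Sum>v\<in>V. Y v * max 0 (9/16 - y v))) {0..9/16}"
      by (rule has_integral_sum [OF assms(1) int])
    show "((\<lambda>x. a * (1 / (1 - sqrt x))) has_integral a * (4 * ln 2 - 3 / 2)) {0..9/16}"
      by (rule has_integral_mult_right [OF has_integral_inverse_one_minus_sqrt])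
    show "(\<Sum>v\<in>V. if y v \<le> x then Y v else 0) \<le> a * (1 / (1 - sqrt x))" if "x \<in> {0..9/16}" for x
      using le [of x] that assms(1) by (simp add: sum.inter_filter)
  qed
  also have "\<dots> \<le> a * (23 / 18)" using a ln2_le_25_over_36 by (intro mult_left_mono) auto
  finally show ?thesis .
qed

lemma numeric_ratio:
  "184 / 81 / (1 - exp (- 23 / 18)) \<le> 2 * exp 1 / (exp 1 - (1::real))"
proof -
  let ?u = "exp (- 1 :: real)"
  have e: "exp (1::real) < 272 / 100" using e_less_272 by simp
  then have "1 / (272 / 100) < 1 / exp (1::real)" by (intro divide_strict_left_mono) auto
  then have u: "100 / 272 < ?u" by (simp add: exp_minus inverse_eq_divide)
  have u1: "?u < 1" by simp
  have "1 + 5 / 18 + (5 / 18)\<^sup>2 / 2 \<le> exp (5 / 18 :: real)" by (rule exp_lower_Taylor_quadratic) simp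
  then have "853 / 648 \<le> exp (5 / 18 :: real)" by (simp add: power2_eq_square)
  then have "inverse (exp (5 / 18 :: real)) \<le> inverse (853 / 648)" by (intro le_imp_inverse_le) auto
  then have "exp (- 5 / 18 :: real) \<le> 648 / 853" by (simp add: exp_minus)
  then have "?u * exp (- 5 / 18) \<le> ?u * (648 / 853)" by (intro mult_left_mono) auto
  then have g: "exp (- 23 / 18 :: real) \<le> ?u * (648 / 853)" by (simp add: exp_add [symmetric])
  have main: "184 / 81 * (1 - ?u) \<le> 2 * (1 - exp (- 23 / 18))" using g u by simp
  have "2 * exp 1 / (exp 1 - (1::real)) = 2 / (1 - ?u)"
    by (simp add: exp_minus field_simps)
  moreover have "184 / 81 / (1 - exp (- 23 / 18 :: real)) \<le> 2 / (1 - ?u)"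
    using main u1 by (simp add: divide_le_eq pos_le_divide_eq field_simps)
  ultimately show ?thesis by simp
qed

subsection \<open>Expectations over independent edges\<close>

definition expect :: "'e set \<Rightarrow> ('e \<Rightarrow> real) \<Rightarrow> ('e set \<Rightarrow> real) \<Rightarrow> real" where
  "expect E p F = (\<Sum>\<phi>\<in>Pow E. (\<Prod>e\<in>\<phi>. p e) * (\<Prod>e\<in>E - \<phi>. 1 - p e) * F \<phi>)"

lemma expect_disjoint_Un:
  assumes "finite A" "finite B" "A \<inter> B = {}"
  shows "expect (A \<union> B) p F = expect A p (\<lambda>\<phi>. expect B p (\<lambda>\<psi>. F (\<phi> \<union> \<psi>)))"
proof -
  let ?w = "\<lambda>E \<phi>. (\<Prod>e\<in>\<phi>. p e) * (\<Prod>e\<in>E - \<phi>. 1 - p e)"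
  have bij: "bij_betw (\<lambda>(\<phi>, \<psi>). \<phi> \<union> \<psi>) (Pow A \<times> Pow B) (Pow (A \<union> B))"
    by (rule bij_betw_byWitness [where f' = "\<lambda>\<phi>. (\<phi> \<inter> A, \<phi> \<inter> B)"]) (use assms in auto)
  have w: "?w (A \<union> B) (\<phi> \<union> \<psi>) = ?w A \<phi> * ?w B \<psi>" if "\<phi> \<subseteq> A" "\<psi> \<subseteq> B" for \<phi> \<psi>
  proof -
    have f: "finite \<phi>" "finite \<psi>" using that assms(1,2) by (auto dest: finite_subset)
    have "A \<union> B - (\<phi> \<union> \<psi>) = (A - \<phi>) \<union> (B - \<psi>)" using that assms by blast
    moreover have "\<phi> \<inter> \<psi> = {}" "(A - \<phi>) \<inter> (B - \<psi>) = {}" using that assms by blast+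
    ultimately show ?thesis using f assms by (simp add: prod.union_disjoint algebra_simps)
  qed
  have "expect (A \<union> B) p F = (\<Sum>(\<phi>, \<psi>)\<in>Pow A \<times> Pow B. ?w (A \<union> B) (\<phi> \<union> \<psi>) * F (\<phi> \<union> \<psi>))"
    unfolding expect_def by (subst sum.reindex_bij_betw [OF bij, symmetric]) (simp add: case_prod_unfold)
  also have "\<dots> = (\<Sum>(\<phi>, \<psi>)\<in>Pow A \<times> Pow B. ?w A \<phi> * (?w B \<psi> * F (\<phi> \<union> \<psi>)))"
    by (rule sum.cong) (auto simp: w mult.assoc)
  also have "\<dots> = (\<Sum>\<phi>\<in>Pow A. \<Sum>\<psi>\<in>Pow B. ?w A \<phi> * (?w B \<psi> * F (\<phi> \<union> \<psi>)))"
    by (rule sum.cartesian_product [symmetric])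
  also have "\<dots> = expect A p (\<lambda>\<phi>. expect B p (\<lambda>\<psi>. F (\<phi> \<union> \<psi>)))"
    by (simp add: expect_def sum_distrib_left)
  finally show ?thesis .
qed

lemma expect_cong: "(\<And>\<phi>. \<phi> \<subseteq> E \<Longrightarrow> F \<phi> = G \<phi>) \<Longrightarrow> expect E p F = expect E p G"
  unfolding expect_def by (intro sum.cong) auto

lemma expect_cmult: "expect E p (\<lambda>\<phi>. c * F \<phi>) = c * expect E p F"
  by (simp add: expect_def sum_distrib_left algebra_simps)

lemma expect_sum: "expect E p (\<lambda>\<phi>. \<Sum>i\<in>I. F i \<phi>) = (\<Sum>i\<in>I. expect E p (F i))"
  unfolding expect_def sum_distrib_left by (rule sum.swap)

lemma expect_singleton: "expect {e} p F = p e * F {e} + (1 - p e) * F {}"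
  by (simp add: expect_def Pow_insert)

lemma expect_empty: "expect {} p F = F {}"
  by (simp add: expect_def)

lemma expect_const: "finite E \<Longrightarrow> expect E p (\<lambda>_. c) = c"
proof (induction E rule: finite_induct)
  case (insert e E)
  then show ?case using expect_disjoint_Un [of "{e}" E p "\<lambda>_. c"]
    by (simp add: expect_singleton algebra_simps)
qed (simp add: expect_empty)

lemma expect_diff: "expect E p (\<lambda>\<phi>. F \<phi> - G \<phi>) = expect E p F - expect E p G"
  by (simp add: expect_def sum_subtractf algebra_simps)

lemma expect_mono:
  assumes "\<And>e. e \<in> E \<Longrightarrow> 0 \<le> p e \<and> p e \<le> 1" "\<And>\<phi>. \<phi> \<subseteq> E \<Longrightarrow> F \<phi> \<le> G \<phi>"
  shows "expect E p F \<le> expect E p G"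
  unfolding expect_def using assms
  by (intro sum_mono mult_left_mono mult_nonneg_nonneg prod_nonneg) auto

lemma expect_indep:
  assumes "finite E" "A \<subseteq> E"
    and F: "\<And>\<phi>. \<phi> \<subseteq> E \<Longrightarrow> F \<phi> = F (\<phi> \<inter> A)" and G: "\<And>\<phi>. \<phi> \<subseteq> E \<Longrightarrow> G \<phi> = G (\<phi> - A)"
  shows "expect E p (\<lambda>\<phi>. F \<phi> * G \<phi>) = expect E p F * expect E p G"
proof -
  have fin: "finite A" "finite (E - A)" "A \<inter> (E - A) = {}" and E: "E = A \<union> (E - A)"
    using assms finite_subset by auto
  have F': "F (\<phi> \<union> \<psi>) = F \<phi>" and G': "G (\<phi> \<union> \<psi>) = G \<psi>"
    if "\<phi> \<subseteq> A" "\<psi> \<subseteq> E - A" for \<phi> \<psi>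
  proof -
    have "(\<phi> \<union> \<psi>) \<inter> A = \<phi>" "(\<phi> \<union> \<psi>) - A = \<psi>" "\<phi> \<union> \<psi> \<subseteq> E" using that assms(2) by auto
    then show "F (\<phi> \<union> \<psi>) = F \<phi>" "G (\<phi> \<union> \<psi>) = G \<psi>" using F [of "\<phi> \<union> \<psi>"] G [of "\<phi> \<union> \<psi>"] by auto
  qed
  have split: "expect E p H = expect A p (\<lambda>\<phi>. expect (E - A) p (\<lambda>\<psi>. H (\<phi> \<union> \<psi>)))" for H
    using expect_disjoint_Un [OF fin] E by metis
  have "expect E p F = expect A p F"
    unfolding split using fin(2) by (auto intro!: expect_cong simp: F' expect_const cong: expect_cong)
  moreover have "expect E p G = expect (E - A) p G"
    unfolding split using fin by (subst expect_const [OF fin(1), symmetric, of _ p]) (auto intro!: expect_cong simp: G')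
  moreover have "expect E p (\<lambda>\<phi>. F \<phi> * G \<phi>) = expect A p (\<lambda>\<phi>. expect (E - A) p (\<lambda>\<psi>. F \<phi> * G \<psi>))"
    unfolding split by (auto intro!: expect_cong simp: F' G')
  ultimately show ?thesis by (simp add: expect_cmult mult.commute [of _ "expect (E - A) p G"])
qed

lemma expect_prod_indep:
  assumes "finite E" "finite I" and A: "\<And>i. i \<in> I \<Longrightarrow> A i \<subseteq> E"
    and disj: "\<And>i j. i \<in> I \<Longrightarrow> j \<in> I \<Longrightarrow> i \<noteq> j \<Longrightarrow> A i \<inter> A j = {}"
    and F: "\<And>i \<phi>. i \<in> I \<Longrightarrow> \<phi> \<subseteq> E \<Longrightarrow> F i \<phi> = F i (\<phi> \<inter> A i)"
  shows "expect E p (\<lambda>\<phi>. \<Prod>i\<in>I. F i \<phi>) = (\<Prod>i\<in>I. expect E p (F i))"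
  using assms(2) A disj F
proof (induction I rule: finite_induct)
  case empty
  then show ?case using assms(1) by (simp add: expect_const)
next
  case (insert i I)
  have "expect E p (\<lambda>\<phi>. F i \<phi> * (\<Prod>j\<in>I. F j \<phi>)) = expect E p (F i) * expect E p (\<lambda>\<phi>. \<Prod>j\<in>I. F j \<phi>)"
  proof (rule expect_indep [OF assms(1)])
    show "A i \<subseteq> E" using insert.prems by auto
    show "F i \<phi> = F i (\<phi> \<inter> A i)" if "\<phi> \<subseteq> E" for \<phi> using insert.prems(3) that by blast
    show "(\<Prod>j\<in>I. F j \<phi>) = (\<Prod>j\<in>I. F j (\<phi> - A i))" if "\<phi> \<subseteq> E" for \<phi>
    proof (rule prod.cong [OF refl])
      fix j assume j: "j \<in> I"
      then have "A i \<inter> A j = {}" using insert by blast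
      then have "(\<phi> - A i) \<inter> A j = \<phi> \<inter> A j" by blast
      then show "F j \<phi> = F j (\<phi> - A i)"
        using insert.prems(3) [of j \<phi>] insert.prems(3) [of j "\<phi> - A i"] j that
        by (metis Diff_subset insertCI subset_trans)
    qed
  qed
  then show ?case using insert by simp
qed

lemma expect_edge:
  assumes "finite E" "e \<in> E"
  shows "expect E p (\<lambda>\<phi>. of_bool (e \<in> \<phi>)) = p e"
proof -
  have "expect E p (\<lambda>\<phi>. of_bool (e \<in> \<phi>)) = expect ({e} \<union> (E - {e})) p (\<lambda>\<phi>. of_bool (e \<in> \<phi>))"
    using assms by (simp add: insert_absorb)
  also have "\<dots> = p e * expect (E - {e}) p (\<lambda>_. 1) + (1 - p e) * expect (E - {e}) p (\<lambda>_. 0)"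
    using assms(1) by (subst expect_disjoint_Un) (auto simp: expect_singleton intro!: arg_cong2 [of _ _ _ _ "(+)"] arg_cong2 [of _ _ _ _ "(*)"] expect_cong)
  finally show ?thesis using assms by (simp add: expect_const)
qed

subsection \<open>Reachability in an in-arborescence\<close>

locale in_tree =
  fixes V :: "'a set" and E :: "('a \<times> 'a) set" and p :: "'a \<times> 'a \<Rightarrow> real" and r :: 'a
  assumes influence_graph: "influence_graph V E p" and in_arborescence: "in_arborescence V E r"
begin

lemma finite_V: "finite V" and E_subset: "E \<subseteq> V \<times> V"
  and p_bounds: "e \<in> E \<Longrightarrow> 0 \<le> p e \<and> p e \<le> 1"
  using influence_graph by (auto simp: influence_graph_def)

lemma finite_E: "finite E"
  using finite_V E_subset finite_subset by blast

lemma r_in_V: "r \<in> V"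
  using in_arborescence by (simp add: in_arborescence_def)

lemma out_unique: "(x, y) \<in> E \<Longrightarrow> (x, z) \<in> E \<Longrightarrow> y = z"
  using in_arborescence E_subset unfolding in_arborescence_def by blast

lemma no_cycle: "(v, v) \<notin> E\<^sup>+"
proof
  assume v: "(v, v) \<in> E\<^sup>+"
  have step: "(u, u) \<in> E\<^sup>+" if "(v, u) \<in> E\<^sup>*" for u
    using that
  proof (induction rule: rtrancl_induct)
    case base
    show ?case by (rule v)
  next
    case (step u z)
    from step.IH obtain u' where "(u, u') \<in> E" "(u', u) \<in> E\<^sup>*" by (meson tranclD)
    with step.hyps out_unique have "(z, u) \<in> E\<^sup>*" by metis
    with step.hyps show ?case by (meson rtrancl_into_trancl1)
  qed
  have "v \<in> V" using v E_subset by (metis mem_Sigma_iff subsetD tranclD)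
  then have "(v, r) \<in> E\<^sup>*" using in_arborescence by (simp add: in_arborescence_def)
  with step have "(r, r) \<in> E\<^sup>+" by blast
  then show False using in_arborescence by (metis in_arborescence_def tranclD)
qed

lemma wf_E: "wf E"
  using finite_E no_cycle by (intro finite_acyclic_wf) (auto simp: acyclic_def)

lemma children_disjoint:
  assumes "(i, w) \<in> E" "(j, w) \<in> E" "(y, i) \<in> E\<^sup>*" "(y, j) \<in> E\<^sup>*"
  shows "i = j"
proof -
  have False if "(a, b) \<in> E\<^sup>*" "a \<noteq> b" "(a, w) \<in> E" "(b, w) \<in> E" for a b
  proof -
    from that obtain c where "(a, c) \<in> E" "(c, b) \<in> E\<^sup>*" by (meson converse_rtranclE)
    with that out_unique have "(w, b) \<in> E\<^sup>*" by metis
    with that no_cycle show False by (meson rtrancl_into_trancl1)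
  qed
  moreover have "(i, j) \<in> E\<^sup>* \<or> (j, i) \<in> E\<^sup>*"
    using assms(3,4) out_unique by (intro single_valued_confluent) (auto simp: single_valued_def)
  ultimately show ?thesis using assms by metis
qed

abbreviation \<E> :: "(('a \<times> 'a) set \<Rightarrow> real) \<Rightarrow> real" where
  "\<E> \<equiv> expect E p"

lemma E_mono: "(\<And>\<phi>. \<phi> \<subseteq> E \<Longrightarrow> F \<phi> \<le> G \<phi>) \<Longrightarrow> \<E> F \<le> \<E> G"
  by (rule expect_mono) (use p_bounds in auto)

lemma E_nonneg: "(\<And>\<phi>. 0 \<le> F \<phi>) \<Longrightarrow> 0 \<le> \<E> F"
  using E_mono [of "\<lambda>_. 0" F] by (simp add: expect_const finite_E)

definition reach_prob :: "'a set \<Rightarrow> 'a \<Rightarrow> real" where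
  "reach_prob U w = \<E> (\<lambda>\<phi>. of_bool (w \<in> Gamma V U \<phi>))"

lemma reach_prob_nonneg: "0 \<le> reach_prob U w"
  unfolding reach_prob_def by (rule E_nonneg) simp

lemma reach_prob_le_1: "reach_prob U w \<le> 1"
proof -
  have "reach_prob U w \<le> \<E> (\<lambda>_. 1)" unfolding reach_prob_def by (rule E_mono) simp
  then show ?thesis by (simp add: expect_const finite_E)
qed

lemma reach_prob_mono: "U \<subseteq> U' \<Longrightarrow> reach_prob U w \<le> reach_prob U' w"
  unfolding reach_prob_def by (rule E_mono) (auto simp: Gamma_def)

lemma self_in_Gamma: "w \<in> U \<Longrightarrow> w \<in> V \<Longrightarrow> w \<in> Gamma V U \<phi>"
  by (auto simp: Gamma_def)

lemma reach_prob_self: "w \<in> U \<Longrightarrow> w \<in> V \<Longrightarrow> reach_prob U w = 1"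
  using expect_const [OF finite_E, of p 1] unfolding reach_prob_def by (simp add: self_in_Gamma)

lemma Gamma_iff_upstream:
  assumes "\<phi> \<subseteq> E" "\<And>x y. (x, y) \<in> E \<Longrightarrow> (y, i) \<in> E\<^sup>* \<Longrightarrow> (x, y) \<in> A"
  shows "i \<in> Gamma V U \<phi> \<longleftrightarrow> i \<in> Gamma V U (\<phi> \<inter> A)"
proof -
  have "(u, i) \<in> (\<phi> \<inter> A)\<^sup>*" if "(u, i) \<in> \<phi>\<^sup>*" for u
    using that
  proof (induction rule: converse_rtrancl_induct)
    case (step y z)
    have "(z, i) \<in> E\<^sup>*" using step.hyps(2) rtrancl_mono [OF assms(1)] by (rule rev_subsetD)
    then have "(y, z) \<in> \<phi> \<inter> A" using step.hyps(1) assms by auto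
    with step.IH show ?case by (meson converse_rtrancl_into_rtrancl)
  qed simp
  moreover have "(u, i) \<in> \<phi>\<^sup>*" if "(u, i) \<in> (\<phi> \<inter> A)\<^sup>*" for u
    using that rtrancl_mono [of "\<phi> \<inter> A" \<phi>] by auto
  ultimately show ?thesis by (auto simp: Gamma_def)
qed

lemma reach_prob_cong:
  assumes "\<And>u. (u, w) \<in> E\<^sup>* \<Longrightarrow> u \<in> U \<longleftrightarrow> u \<in> U'"
  shows "reach_prob U w = reach_prob U' w"
proof -
  have "w \<in> Gamma V U \<phi> \<longleftrightarrow> w \<in> Gamma V U' \<phi>" if "\<phi> \<subseteq> E" for \<phi>
  proof -
    have "u \<in> U \<longleftrightarrow> u \<in> U'" if "(u, w) \<in> \<phi>\<^sup>*" for u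
      using that rtrancl_mono [OF \<open>\<phi> \<subseteq> E\<close>] by (intro assms) (rule rev_subsetD)
    then show ?thesis unfolding Gamma_def by blast
  qed
  then show ?thesis unfolding reach_prob_def by (intro expect_cong) simp
qed

lemma reach_prob_empty: "reach_prob {} w = 0"
  by (simp add: reach_prob_def Gamma_def expect_const finite_E)

definition children :: "'a \<Rightarrow> 'a set" where
  "children w = {i. (i, w) \<in> E}"

lemma finite_children: "finite (children w)"
  using E_subset by (intro finite_subset [OF _ finite_V]) (auto simp: children_def)

lemma one_minus_reach_prob:
  assumes "w \<in> V" "w \<notin> U"
  shows "1 - reach_prob U w = (\<Prod>i\<in>children w. 1 - p (i, w) * reach_prob U i)"
proof -
  define A where "A i = {(x, y) \<in> E. (x, i) \<in> E\<^sup>*}" for i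
  define F :: "'a \<Rightarrow> ('a \<times> 'a) set \<Rightarrow> real" where
    "F i \<phi> = 1 - of_bool ((i, w) \<in> \<phi>) * of_bool (i \<in> Gamma V U \<phi>)" for i \<phi>
  have Gamma_step: "w \<in> Gamma V U \<phi> \<longleftrightarrow> (\<exists>i\<in>children w. (i, w) \<in> \<phi> \<and> i \<in> Gamma V U \<phi>)"
    if "\<phi> \<subseteq> E" for \<phi>
  proof
    assume "w \<in> Gamma V U \<phi>"
    then obtain u where u: "u \<in> U \<inter> V" "(u, w) \<in> \<phi>\<^sup>*" by (auto simp: Gamma_def)
    with assms obtain i where i: "(u, i) \<in> \<phi>\<^sup>*" "(i, w) \<in> \<phi>" by (metis IntD1 rtranclE)
    with that E_subset have "i \<in> V" "i \<in> children w" by (auto simp: children_def)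
    with i u show "\<exists>i\<in>children w. (i, w) \<in> \<phi> \<and> i \<in> Gamma V U \<phi>" by (auto simp: Gamma_def)
  next
    assume "\<exists>i\<in>children w. (i, w) \<in> \<phi> \<and> i \<in> Gamma V U \<phi>"
    then show "w \<in> Gamma V U \<phi>" using assms(1) by (auto simp: Gamma_def intro: rtrancl_into_rtrancl)
  qed
  have "1 - reach_prob U w = \<E> (\<lambda>\<phi>. 1 - of_bool (w \<in> Gamma V U \<phi>))"
    by (simp add: reach_prob_def expect_diff expect_const finite_E)
  also have "\<dots> = \<E> (\<lambda>\<phi>. \<Prod>i\<in>children w. F i \<phi>)"
  proof (rule expect_cong)
    fix \<phi> assume "\<phi> \<subseteq> E"
    show "1 - of_bool (w \<in> Gamma V U \<phi>) = (\<Prod>i\<in>children w. F i \<phi>)"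
    proof (cases "w \<in> Gamma V U \<phi>")
      case True
      then show ?thesis using Gamma_step [OF \<open>\<phi> \<subseteq> E\<close>] finite_children
        by (auto simp: F_def intro!: prod_zero [symmetric])
    next
      case False
      then have "F i \<phi> = 1" if "i \<in> children w" for i
        using Gamma_step [OF \<open>\<phi> \<subseteq> E\<close>] that by (auto simp: F_def)
      then show ?thesis using False by simp
    qed
  qed
  also have "\<dots> = (\<Prod>i\<in>children w. \<E> (F i))"
  proof (rule expect_prod_indep [OF finite_E finite_children, where A = A])
    show "A i \<inter> A j = {}" if "i \<in> children w" "j \<in> children w" "i \<noteq> j" for i j
      using children_disjoint that by (fastforce simp: A_def children_def)
    show "F i \<phi> = F i (\<phi> \<inter> A i)" if "i \<in> children w" "\<phi> \<subseteq> E" for i \<phi>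
      using that Gamma_iff_upstream [of \<phi> i "A i" U]
      by (auto simp: F_def A_def children_def intro: converse_rtrancl_into_rtrancl)
  qed (auto simp: A_def)
  also have "\<dots> = (\<Prod>i\<in>children w. 1 - p (i, w) * reach_prob U i)"
  proof (rule prod.cong [OF refl])
    fix i assume i: "i \<in> children w"
    then have e: "(i, w) \<in> E" by (simp add: children_def)
    then have "(w, i) \<notin> E\<^sup>*" using no_cycle by (meson rtrancl_into_trancl2)
    then have "i \<in> Gamma V U \<phi> \<longleftrightarrow> i \<in> Gamma V U (\<phi> - {(i, w)})" if "\<phi> \<subseteq> E" for \<phi>
      using Gamma_iff_upstream [OF that, of i "- {(i, w)}" U] by (auto simp: Diff_eq)
    then have "\<E> (\<lambda>\<phi>. of_bool ((i, w) \<in> \<phi>) * of_bool (i \<in> Gamma V U \<phi>)) = p (i, w) * reach_prob U i"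
      using e finite_E unfolding reach_prob_def
      by (subst expect_indep [where A = "{(i, w)}"]) (auto simp: expect_edge)
    then show "\<E> (F i) = 1 - p (i, w) * reach_prob U i"
      unfolding F_def by (simp add: expect_diff expect_const finite_E)
  qed
  finally show ?thesis .
qed

text \<open>The factor \<open>c\<close> carries the probability that \<open>S\<close> misses the part of the path below \<open>w\<close>. The number
  \<open>c * (1 - reach_prob S w)\<close> does not change when several branches are merged, and for a constant exponent
  both sides are multiplicative over the branches.\<close>

lemma tree_bound:
  assumes "w \<in> V" and \<eta>: "0 \<le> \<eta>"
    and U: "\<And>v. v \<in> U \<Longrightarrow> c * (reach_prob (insert v S) w - reach_prob S w) \<le> \<eta> * reach_prob {v} w"
    and m: "c * (1 - reach_prob S w) > \<eta>"
  shows "(1 - reach_prob S w) powr gam \<eta> (c * (1 - reach_prob S w)) \<le> 1 - reach_prob U w"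
  using wf_E assms(1) U m
proof (induction w arbitrary: c rule: wf_induct_rule)
  case (less w)
  let ?I = "children w"
  let ?m = "c * (1 - reach_prob S w)"
  have w: "w \<notin> U"
  proof
    assume "w \<in> U"
    then show False using less.prems(2) [of w] less.prems(3) reach_prob_self [of w] less.prems(1) by simp
  qed
  show ?case
  proof (cases "w \<in> S")
    case True
    then show ?thesis using less.prems \<eta> reach_prob_self by simp
  next
    case wS: False
    define q where "q i = (\<Prod>j\<in>?I - {i}. 1 - p (j, w) * reach_prob S j)" for i
    have q: "1 - reach_prob S w = q i * (1 - p (i, w) * reach_prob S i)" if "i \<in> ?I" for i
      unfolding q_def using one_minus_reach_prob [OF less.prems(1) wS] prod.remove [OF finite_children that]
      by (simp add: mult.commute)
    have child: "(1 - p (i, w) * reach_prob S i) powr gam \<eta> ?m \<le> 1 - p (i, w) * reach_prob U i" if i: "i \<in> ?I" for i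
    proof -
      have e: "(i, w) \<in> E" and iV: "i \<in> V" using i E_subset by (auto simp: children_def)
      have m: "?m = c * q i * (1 - p (i, w) * reach_prob S i)" using q [OF i] by simp
      show ?thesis
      proof (cases "p (i, w) = 0")
        case True
        then show ?thesis by simp
      next
        case False
        then have p0: "0 < p (i, w)" using p_bounds [OF e] by simp
        have hyp: "c * q i * (reach_prob (insert v S) i - reach_prob S i) \<le> \<eta> * reach_prob {v} i" if v: "v \<in> U" for v
        proof (cases "(v, i) \<in> E\<^sup>*")
          case False
          then have "reach_prob (insert v S) i = reach_prob S i" by (intro reach_prob_cong) auto
          then show ?thesis using \<eta> reach_prob_nonneg by simp
        next
          case True
          have vw: "w \<noteq> v" using w v by auto
          have other: "reach_prob (insert v S') j = reach_prob S' j" if "j \<in> ?I - {i}" for j S'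
            using that children_disjoint [OF e, of j v] True by (intro reach_prob_cong) (auto simp: children_def)
          have "(\<Prod>j\<in>?I - {i}. 1 - p (j, w) * reach_prob {v} j) = 1"
            using other [of _ "{}"] by (intro prod.neutral) (auto simp: reach_prob_empty)
          then have "1 - reach_prob {v} w = 1 - p (i, w) * reach_prob {v} i"
            using one_minus_reach_prob [OF less.prems(1), of "{v}"] vw
              prod.remove [OF finite_children i, of "\<lambda>j. 1 - p (j, w) * reach_prob {v} j"] by simp
          moreover have "(\<Prod>j\<in>?I - {i}. 1 - p (j, w) * reach_prob (insert v S) j) = q i"
            unfolding q_def using other [of _ S] by (intro prod.cong) auto
          then have "1 - reach_prob (insert v S) w = q i * (1 - p (i, w) * reach_prob (insert v S) i)"
            using one_minus_reach_prob [OF less.prems(1), of "insert v S"] vw wS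
              prod.remove [OF finite_children i, of "\<lambda>j. 1 - p (j, w) * reach_prob (insert v S) j"] by simp
          then have "reach_prob (insert v S) w - reach_prob S w = q i * p (i, w) * (reach_prob (insert v S) i - reach_prob S i)"
            using q [OF i] by (simp add: algebra_simps)
          ultimately have "c * (q i * p (i, w) * (reach_prob (insert v S) i - reach_prob S i)) \<le> \<eta> * (p (i, w) * reach_prob {v} i)"
            using less.prems(2) [OF v] by simp
          then have "p (i, w) * (c * q i * (reach_prob (insert v S) i - reach_prob S i)) \<le> p (i, w) * (\<eta> * reach_prob {v} i)"
            by (simp add: algebra_simps)
          then show ?thesis using p0 by simp
        qed
        show ?thesis unfolding m
        proof (rule chain_bound [OF \<eta>])
          show "c * q i * (1 - p (i, w) * reach_prob S i) > \<eta>" using less.prems(3) m by simp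
          show "(1 - reach_prob S i) powr gam \<eta> (c * q i * (1 - reach_prob S i)) \<le> 1 - reach_prob U i"
            if "c * q i * (1 - reach_prob S i) > \<eta>" using less.IH [OF e iV hyp that] by simp
        qed (use p_bounds [OF e] reach_prob_nonneg reach_prob_le_1 in auto)
      qed
    qed
    have "(1 - reach_prob S w) powr gam \<eta> ?m = (\<Prod>i\<in>?I. (1 - p (i, w) * reach_prob S i) powr gam \<eta> ?m)"
      by (subst one_minus_reach_prob [OF less.prems(1) wS]) (simp add: prod_powr_distrib)
    also have "\<dots> \<le> (\<Prod>i\<in>?I. 1 - p (i, w) * reach_prob U i)"
      by (intro prod_mono) (use child in auto)
    also have "\<dots> = 1 - reach_prob U w" by (rule one_minus_reach_prob [OF less.prems(1) w, symmetric])
    finally show ?thesis .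
  qed
qed

lemma reach_prob_threshold_bound:
  assumes "w \<in> V" "0 \<le> \<eta>" "\<eta> < 1"
    and "\<And>v. v \<in> U \<Longrightarrow> reach_prob (insert v S) w - reach_prob S w \<le> \<eta> * reach_prob {v} w"
  shows "reach_prob U w \<le> reach_prob S w / (1 - sqrt \<eta>)"
proof (cases "\<eta> < 1 - reach_prob S w")
  case True
  then have "(1 - reach_prob S w) powr gam \<eta> (1 - reach_prob S w) \<le> 1 - reach_prob U w"
    using tree_bound [of w \<eta> U 1 S] assms by simp
  then show ?thesis using powr_gam_linear [OF assms(2) True reach_prob_nonneg] by linarith
next
  case False
  have "sqrt \<eta> * sqrt \<eta> \<le> sqrt \<eta> * 1" using assms by (intro mult_left_mono) auto
  then have "\<eta> \<le> sqrt \<eta>" using assms by simp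
  then have "1 - sqrt \<eta> \<le> reach_prob S w" using False by linarith
  then have "1 \<le> reach_prob S w / (1 - sqrt \<eta>)" using assms by simp
  with reach_prob_le_1 show ?thesis by (rule order_trans)
qed

end

subsection \<open>Adaptive policies\<close>

declare run_policy.simps(2) [simp del]

lemma run_policy_mono: "m \<le> n \<Longrightarrow> set (run_policy V E \<pi> \<phi> m) \<subseteq> set (run_policy V E \<pi> \<phi> n)"
proof (induction n)
  case (Suc n)
  have "set (run_policy V E \<pi> \<phi> n) \<subseteq> set (run_policy V E \<pi> \<phi> (Suc n))"
    by (auto simp: run_policy.simps(2) Let_def split: option.splits)
  then show ?case using Suc by (cases "m = Suc n") auto
qed simp

lemma Gamma_mono: "S \<subseteq> T \<Longrightarrow> Gamma V S \<phi> \<subseteq> Gamma V T \<phi>"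
  by (auto simp: Gamma_def)

definition first_reach :: "'a set \<Rightarrow> ('a \<times> 'a) set \<Rightarrow> 'a policy \<Rightarrow> 'a \<Rightarrow> 'a \<Rightarrow> ('a \<times> 'a) set \<Rightarrow> bool" where
  "first_reach V E \<pi> w v \<phi> \<longleftrightarrow> (\<exists>n. run_policy V E \<pi> \<phi> (Suc n) = run_policy V E \<pi> \<phi> n @ [v] \<and>
     w \<notin> Gamma V (set (run_policy V E \<pi> \<phi> n)) \<phi> \<and> w \<in> Gamma V (set (run_policy V E \<pi> \<phi> (Suc n))) \<phi>)"

lemma first_reach_ex:
  assumes "w \<in> Gamma V (policy_seeds V E \<pi> \<phi>) \<phi>"
  shows "\<exists>v. first_reach V E \<pi> w v \<phi>"
proof -
  let ?P = "\<lambda>n. w \<in> Gamma V (set (run_policy V E \<pi> \<phi> n)) \<phi>"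
  have ex: "\<exists>n. ?P n" using assms by (auto simp: Gamma_def policy_seeds_def)
  define n where "n = (LEAST n. ?P n)"
  have n: "?P n" and least: "\<And>m. m < n \<Longrightarrow> \<not> ?P m"
    using LeastI_ex [OF ex] not_less_Least unfolding n_def by blast+
  have "n \<noteq> 0" using n by (intro notI) (simp add: Gamma_def)
  then obtain m where m: "n = Suc m" using not0_implies_Suc by blast
  have not: "\<not> ?P m" using least m by simp
  then have "run_policy V E \<pi> \<phi> (Suc m) \<noteq> run_policy V E \<pi> \<phi> m" using n m by metis
  then obtain v where "run_policy V E \<pi> \<phi> (Suc m) = run_policy V E \<pi> \<phi> m @ [v]"
    by (auto simp: run_policy.simps(2) Let_def split: option.splits)
  then show ?thesis using n m not unfolding first_reach_def by blast
qed

lemma first_reach_unique: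
  assumes "first_reach V E \<pi> w v \<phi>" "first_reach V E \<pi> w u \<phi>"
  shows "v = u"
proof -
  let ?run = "run_policy V E \<pi> \<phi>"
  from assms obtain m n where
    m: "?run (Suc m) = ?run m @ [v]" "w \<notin> Gamma V (set (?run m)) \<phi>" "w \<in> Gamma V (set (?run (Suc m))) \<phi>" and
    n: "?run (Suc n) = ?run n @ [u]" "w \<notin> Gamma V (set (?run n)) \<phi>" "w \<in> Gamma V (set (?run (Suc n))) \<phi>"
    unfolding first_reach_def by blast
  have "\<not> Suc m \<le> n"
    using m(3) n(2) Gamma_mono [OF run_policy_mono [of "Suc m" n V E \<pi> \<phi>], of V \<phi>] by blast
  moreover have "\<not> Suc n \<le> m"
    using n(3) m(2) Gamma_mono [OF run_policy_mono [of "Suc n" m V E \<pi> \<phi>], of V \<phi>] by blast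
  ultimately have "m = n" by simp
  with m n show ?thesis by simp
qed

lemma first_reach_Gamma:
  assumes "first_reach V E \<pi> w v \<phi>"
  shows "w \<in> Gamma V {v} \<phi>"
  using assms unfolding first_reach_def by (auto simp: Gamma_def)

context in_tree
begin

definition path_edges :: "'a \<Rightarrow> 'a \<Rightarrow> ('a \<times> 'a) set" where
  "path_edges v w = {(y, z) \<in> E. (v, y) \<in> E\<^sup>* \<and> (z, w) \<in> E\<^sup>*}"

lemma path_edges_live:
  assumes "\<phi> \<subseteq> E" "(v, w) \<in> \<phi>\<^sup>*"
  shows "path_edges v w \<subseteq> \<phi>"
  using assms(2)
proof (induction rule: converse_rtrancl_induct)
  case base
  have False if "(y, z) \<in> E" "(w, y) \<in> E\<^sup>*" "(z, w) \<in> E\<^sup>*" for y z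
    using no_cycle rtrancl_into_trancl2 [OF that(1) rtrancl_trans [OF that(3,2)]] by blast
  then show ?case by (auto simp: path_edges_def)
next
  case (step v v')
  have e: "(v, v') \<in> E" using step.hyps(1) assms(1) by blast
  show ?case
  proof clarify
    fix y z assume "(y, z) \<in> path_edges v w"
    then have yz: "(y, z) \<in> E" "(v, y) \<in> E\<^sup>*" "(z, w) \<in> E\<^sup>*" by (auto simp: path_edges_def)
    from yz(2) show "(y, z) \<in> \<phi>"
    proof (cases rule: converse_rtranclE)
      case base
      then show ?thesis using out_unique [OF e] yz(1) step.hyps(1) by auto
    next
      case (step u)
      then have "(v', y) \<in> E\<^sup>*" using out_unique [OF e] by auto
      then show ?thesis using step.IH yz by (auto simp: path_edges_def)
    qed
  qed
qed

lemma path_edges_reach: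
  assumes "(v, w) \<in> E\<^sup>*" "path_edges v w \<subseteq> \<phi>"
  shows "(v, w) \<in> \<phi>\<^sup>*"
  using assms
proof (induction rule: converse_rtrancl_induct)
  case (step v v')
  have "path_edges v' w \<subseteq> path_edges v w"
    using step.hyps(1) by (auto simp: path_edges_def intro: converse_rtrancl_into_rtrancl)
  moreover have "(v, v') \<in> path_edges v w" using step.hyps by (auto simp: path_edges_def)
  ultimately show ?case using step by (meson converse_rtrancl_into_rtrancl subset_iff)
qed simp

lemma Gamma_agree:
  assumes "\<phi> \<subseteq> E" "\<phi> - Q = \<phi>' - Q" "\<And>e. e \<in> Q \<Longrightarrow> fst e \<notin> Gamma V L \<phi>"
  shows "Gamma V L \<phi>' = Gamma V L \<phi>"
proof -
  have keep: "(y, z) \<in> \<phi> \<longleftrightarrow> (y, z) \<in> \<phi>'" if "y \<in> Gamma V L \<phi>" for y z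
    using that assms(2) assms(3) [of "(y, z)"] by auto
  have out: "(u, x) \<in> \<phi>'\<^sup>*" if "(u, x) \<in> \<phi>\<^sup>*" "u \<in> L \<inter> V" for u x
    using that
  proof (induction rule: rtrancl_induct)
    case (step y z)
    have "y \<in> V" using step.hyps(2) assms(1) E_subset by blast
    then have "y \<in> Gamma V L \<phi>" using step.hyps(1) step.prems by (auto simp: Gamma_def)
    then have "(y, z) \<in> \<phi>'" using keep step.hyps(2) by blast
    then show ?case using step.IH [OF step.prems] by (rule rtrancl_into_rtrancl [rotated])
  qed simp
  have "(u, x) \<in> \<phi>\<^sup>* \<and> x \<in> V" if "(u, x) \<in> \<phi>'\<^sup>*" "u \<in> L \<inter> V" for u x
    using that
  proof (induction rule: rtrancl_induct)
    case (step y z)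
    then have y: "(u, y) \<in> \<phi>\<^sup>*" "y \<in> V" by auto
    then have "y \<in> Gamma V L \<phi>" using step.prems by (auto simp: Gamma_def)
    then have "(y, z) \<in> \<phi>" using keep step.hyps(2) by blast
    then show ?case using y assms(1) E_subset by (auto intro: rtrancl_into_rtrancl)
  qed simp
  with out show ?thesis unfolding Gamma_def by blast
qed

lemma run_policy_agree:
  assumes "\<phi> \<subseteq> E" "\<phi> - Q = \<phi>' - Q"
    and "\<And>m e. m < n \<Longrightarrow> e \<in> Q \<Longrightarrow> fst e \<notin> Gamma V (set (run_policy V E \<pi> \<phi> m)) \<phi>"
  shows "run_policy V E \<pi> \<phi>' n = run_policy V E \<pi> \<phi> n"
  using assms(3)
proof (induction n)
  case (Suc n)
  let ?L = "run_policy V E \<pi> \<phi> n"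
  have disj: "fst e \<notin> Gamma V (set ?L) \<phi>" if "e \<in> Q" for e using Suc.prems that by blast
  have L: "run_policy V E \<pi> \<phi>' n = ?L" by (rule Suc.IH) (rule Suc.prems, simp_all)
  have obs: "observed V E (set ?L) \<phi>' = observed V E (set ?L) \<phi>"
    using Gamma_agree [OF assms(1,2) disj] by (simp add: observed_def)
  have "observed V E (set ?L) \<phi> \<inter> Q = {}"
  proof (rule equals0I)
    fix e assume "e \<in> observed V E (set ?L) \<phi> \<inter> Q"
    then show False using disj [of e] by (auto simp: observed_def)
  qed
  then have "observed V E (set ?L) \<phi> \<inter> \<phi>' = observed V E (set ?L) \<phi> \<inter> \<phi>" using assms(2) by blast
  then show ?case by (simp add: run_policy.simps(2) L obs Let_def)
qed simp

text \<open>Unlike \<open>first_reach\<close>, this event does not depend on the status of the edges in \<open>Q\<close>.\<close>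

definition fresh_pick :: "'a policy \<Rightarrow> ('a \<times> 'a) set \<Rightarrow> 'a \<Rightarrow> ('a \<times> 'a) set \<Rightarrow> bool" where
  "fresh_pick \<pi> Q v \<phi> \<longleftrightarrow> (\<exists>n. run_policy V E \<pi> \<phi> (Suc n) = run_policy V E \<pi> \<phi> n @ [v] \<and>
     (\<forall>e\<in>Q. fst e \<notin> Gamma V (set (run_policy V E \<pi> \<phi> n)) \<phi>))"

lemma fresh_pick_agree:
  assumes "\<phi> \<subseteq> E" "\<phi> - Q = \<phi>' - Q" "fresh_pick \<pi> Q v \<phi>"
  shows "fresh_pick \<pi> Q v \<phi>'"
proof -
  from assms(3) obtain n where n: "run_policy V E \<pi> \<phi> (Suc n) = run_policy V E \<pi> \<phi> n @ [v]"
    "\<And>e. e \<in> Q \<Longrightarrow> fst e \<notin> Gamma V (set (run_policy V E \<pi> \<phi> n)) \<phi>" unfolding fresh_pick_def by blast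
  have disj: "fst e \<notin> Gamma V (set (run_policy V E \<pi> \<phi> m)) \<phi>" if "m < Suc n" "e \<in> Q" for m e
  proof -
    have "m \<le> n" using that by simp
    then show ?thesis using n(2) [OF that(2)] Gamma_mono [OF run_policy_mono [of m n V E \<pi> \<phi>], of V \<phi>] by blast
  qed
  have "run_policy V E \<pi> \<phi>' (Suc n) = run_policy V E \<pi> \<phi> (Suc n)"
    by (rule run_policy_agree [OF assms(1,2)]) (rule disj)
  moreover have run: "run_policy V E \<pi> \<phi>' n = run_policy V E \<pi> \<phi> n"
    by (rule run_policy_agree [OF assms(1,2)]) (rule disj, simp_all)
  moreover have "Gamma V (set (run_policy V E \<pi> \<phi> n)) \<phi>' = Gamma V (set (run_policy V E \<pi> \<phi> n)) \<phi>"
    by (rule Gamma_agree [OF assms(1,2) n(2)])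
  ultimately show ?thesis using n unfolding fresh_pick_def by (intro exI [of _ n]) simp
qed

lemma first_reach_fresh:
  assumes "\<phi> \<subseteq> E" "first_reach V E \<pi> w v \<phi>"
  shows "path_edges v w \<subseteq> \<phi>" "fresh_pick \<pi> (path_edges v w) v \<phi>"
proof -
  let ?run = "run_policy V E \<pi> \<phi>"
  have vw: "(v, w) \<in> \<phi>\<^sup>*" "w \<in> V" using first_reach_Gamma [OF assms(2)] by (auto simp: Gamma_def)
  show live: "path_edges v w \<subseteq> \<phi>" by (rule path_edges_live [OF assms(1) vw(1)])
  from assms(2) obtain n where n: "?run (Suc n) = ?run n @ [v]" "w \<notin> Gamma V (set (?run n)) \<phi>"
    unfolding first_reach_def by blast
  have "y \<notin> Gamma V (set (?run n)) \<phi>" if yz: "(y, z) \<in> path_edges v w" for y z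
  proof
    assume "y \<in> Gamma V (set (?run n)) \<phi>"
    moreover have "path_edges y w \<subseteq> path_edges v w"
      using yz unfolding path_edges_def by (blast intro: rtrancl_trans)
    then have "path_edges y w \<subseteq> \<phi>" using live by (rule subset_trans)
    moreover have "(y, w) \<in> E\<^sup>*"
      using yz unfolding path_edges_def by (blast intro: converse_rtrancl_into_rtrancl)
    ultimately have "y \<in> Gamma V (set (?run n)) \<phi>" "(y, w) \<in> \<phi>\<^sup>*" using path_edges_reach by blast+
    then have "w \<in> Gamma V (set (?run n)) \<phi>" using vw(2) unfolding Gamma_def by (blast intro: rtrancl_trans)
    with n(2) show False by contradiction
  qed
  then have "\<forall>e\<in>path_edges v w. fst e \<notin> Gamma V (set (?run n)) \<phi>" by auto
  then show "fresh_pick \<pi> (path_edges v w) v \<phi>" using n(1) unfolding fresh_pick_def by blast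
qed

definition seed_prob :: "'a policy \<Rightarrow> 'a \<Rightarrow> real" where
  "seed_prob \<pi> v = \<E> (\<lambda>\<phi>. of_bool (v \<in> policy_seeds V E \<pi> \<phi>))"

lemma expect_first_reach_le:
  assumes "v \<in> V" "w \<in> V"
  shows "\<E> (\<lambda>\<phi>. of_bool (first_reach V E \<pi> w v \<phi>)) \<le> seed_prob \<pi> v * reach_prob {v} w"
proof (cases "(v, w) \<in> E\<^sup>*")
  case True
  let ?Q = "path_edges v w"
  have "\<E> (\<lambda>\<phi>. of_bool (first_reach V E \<pi> w v \<phi>)) \<le> \<E> (\<lambda>\<phi>. of_bool (?Q \<subseteq> \<phi>) * of_bool (fresh_pick \<pi> ?Q v \<phi>))"
    using first_reach_fresh by (intro E_mono) (auto simp: of_bool_def)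
  also have "\<dots> = \<E> (\<lambda>\<phi>. of_bool (?Q \<subseteq> \<phi>)) * \<E> (\<lambda>\<phi>. of_bool (fresh_pick \<pi> ?Q v \<phi>))"
  proof (rule expect_indep [OF finite_E, where A = ?Q])
    show "of_bool (fresh_pick \<pi> ?Q v \<phi>) = (of_bool (fresh_pick \<pi> ?Q v (\<phi> - ?Q)) :: real)" if "\<phi> \<subseteq> E" for \<phi>
      using fresh_pick_agree [of \<phi> ?Q "\<phi> - ?Q" \<pi> v] fresh_pick_agree [of "\<phi> - ?Q" ?Q \<phi> \<pi> v] that
      by (intro arg_cong [where f = of_bool]) blast
  qed (auto simp: path_edges_def)
  also have "\<dots> \<le> reach_prob {v} w * seed_prob \<pi> v"
  proof (rule mult_mono)
    show "\<E> (\<lambda>\<phi>. of_bool (?Q \<subseteq> \<phi>)) \<le> reach_prob {v} w"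
      unfolding reach_prob_def using path_edges_reach [OF True] assms by (intro E_mono) (auto simp: Gamma_def)
    have "v \<in> policy_seeds V E \<pi> \<phi>" if "fresh_pick \<pi> ?Q v \<phi>" for \<phi>
    proof -
      from that obtain n where "run_policy V E \<pi> \<phi> (Suc n) = run_policy V E \<pi> \<phi> n @ [v]"
        unfolding fresh_pick_def by blast
      then have "v \<in> set (run_policy V E \<pi> \<phi> (Suc n))" by simp
      then show ?thesis unfolding policy_seeds_def by blast
    qed
    then show "\<E> (\<lambda>\<phi>. of_bool (fresh_pick \<pi> ?Q v \<phi>)) \<le> seed_prob \<pi> v"
      unfolding seed_prob_def by (intro E_mono) auto
    show "0 \<le> \<E> (\<lambda>\<phi>. of_bool (fresh_pick \<pi> ?Q v \<phi>))" by (rule E_nonneg) simp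
  qed (rule reach_prob_nonneg)
  finally show ?thesis by (simp add: mult.commute)
next
  case False
  have "(v, w) \<notin> \<phi>\<^sup>*" if "\<phi> \<subseteq> E" for \<phi>
    using False rtrancl_mono [OF that] by blast
  then have "\<not> first_reach V E \<pi> w v \<phi>" if "\<phi> \<subseteq> E" for \<phi>
    using first_reach_Gamma [of V E \<pi> w v \<phi>] that by (auto simp: Gamma_def)
  then have "\<E> (\<lambda>\<phi>. of_bool (first_reach V E \<pi> w v \<phi>)) \<le> \<E> (\<lambda>_. 0)"
    by (intro E_mono) simp
  also have "\<dots> \<le> seed_prob \<pi> v * reach_prob {v} w"
    unfolding seed_prob_def by (simp add: expect_const finite_E reach_prob_nonneg E_nonneg)
  finally show ?thesis .
qed

lemma policy_node_bound:
  assumes \<pi>: "\<pi> \<in> policies_le V E k" and w: "w \<in> V"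
  shows "\<E> (\<lambda>\<phi>. of_bool (w \<in> Gamma V (policy_seeds V E \<pi> \<phi>) \<phi>))
    \<le> 184 / 81 * reach_prob S w + 16 / 9 * (\<Sum>v\<in>V. seed_prob \<pi> v * (reach_prob (insert v S) w - reach_prob S w))"
proof -
  define Y where "Y v = \<E> (\<lambda>\<phi>. of_bool (first_reach V E \<pi> w v \<phi>))" for v
  define d where "d v = reach_prob (insert v S) w - reach_prob S w" for v
  \<comment> \<open>The value 1 lies above every threshold used below; in that case \<open>Y v = 0\<close> anyway.\<close>
  define y where "y v = (if reach_prob {v} w = 0 then 1 else d v / reach_prob {v} w)" for v
  have Y0: "0 \<le> Y v" for v unfolding Y_def by (rule E_nonneg) simp
  have d0: "0 \<le> d v" for v using reach_prob_mono [of S "insert v S"] by (auto simp: d_def)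
  have y0: "0 \<le> y v" for v using d0 reach_prob_nonneg by (simp add: y_def)
  have YU: "(\<Sum>v\<in>U. Y v) \<le> reach_prob U w" if "U \<subseteq> V" for U
  proof -
    have "(\<Sum>v\<in>U. Y v) = \<E> (\<lambda>\<phi>. \<Sum>v\<in>U. of_bool (first_reach V E \<pi> w v \<phi>))"
      by (simp add: Y_def expect_sum)
    also have "\<dots> \<le> reach_prob U w"
      unfolding reach_prob_def
    proof (rule E_mono)
      fix \<phi> show "(\<Sum>v\<in>U. of_bool (first_reach V E \<pi> w v \<phi>)) \<le> (of_bool (w \<in> Gamma V U \<phi>) :: real)"
      proof (cases "\<exists>v\<in>U. first_reach V E \<pi> w v \<phi>")
        case True
        then obtain v where v: "v \<in> U" "first_reach V E \<pi> w v \<phi>" by blast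
        have "finite U" using that finite_V finite_subset by blast
        have "(\<Sum>u\<in>U. of_bool (first_reach V E \<pi> w u \<phi>)) = (\<Sum>u\<in>U. of_bool (u = v) :: real)"
          using v(2) first_reach_unique by (intro sum.cong) (auto simp: of_bool_def)
        also have "\<dots> = 1" using v(1) \<open>finite U\<close> by (simp add: of_bool_def)
        finally show ?thesis using first_reach_Gamma [OF v(2)] Gamma_mono [of "{v}" U V \<phi>] v(1) by auto
      qed simp
    qed
    finally show ?thesis .
  qed
  have "\<E> (\<lambda>\<phi>. of_bool (w \<in> Gamma V (policy_seeds V E \<pi> \<phi>) \<phi>)) \<le> (\<Sum>v\<in>V. Y v)"
    unfolding Y_def expect_sum [symmetric]
  proof (rule E_mono)
    fix \<phi> assume "\<phi> \<subseteq> E"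
    show "of_bool (w \<in> Gamma V (policy_seeds V E \<pi> \<phi>) \<phi>) \<le> (\<Sum>v\<in>V. of_bool (first_reach V E \<pi> w v \<phi>) :: real)"
    proof (cases "w \<in> Gamma V (policy_seeds V E \<pi> \<phi>) \<phi>")
      case True
      obtain v where v: "first_reach V E \<pi> w v \<phi>" using first_reach_ex [OF True] by blast
      then have "v \<in> V" using first_reach_Gamma [OF v] by (auto simp: Gamma_def)
      then have "of_bool (first_reach V E \<pi> w v \<phi>) \<le> (\<Sum>v\<in>V. of_bool (first_reach V E \<pi> w v \<phi>) :: real)"
        by (intro member_le_sum) (use finite_V in auto)
      then show ?thesis using v True by simp
    qed (simp add: sum_nonneg)
  qed
  also have "\<dots> = 16 / 9 * ((\<Sum>v\<in>V. Y v * (9 / 16 - y v)) + (\<Sum>v\<in>V. Y v * y v))"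
    by (simp add: sum.distrib [symmetric] algebra_simps sum_distrib_left)
  also have "\<dots> \<le> 16 / 9 * (reach_prob S w * (23 / 18) + (\<Sum>v\<in>V. seed_prob \<pi> v * d v))"
  proof (intro mult_left_mono add_mono sum_mono)
    show "(\<Sum>v\<in>V. Y v * (9 / 16 - y v)) \<le> reach_prob S w * (23 / 18)"
    proof (rule layer_cake_bound [OF finite_V Y0 y0 reach_prob_nonneg])
      fix \<eta> :: real assume \<eta>: "0 \<le> \<eta>" "\<eta> < 1"
      have "sum Y {v \<in> V. y v \<le> \<eta>} \<le> reach_prob {v \<in> V. y v \<le> \<eta>} w" by (rule YU) auto
      also have "\<dots> \<le> reach_prob S w / (1 - sqrt \<eta>)"
      proof (rule reach_prob_threshold_bound [OF w \<eta>])
        fix v assume "v \<in> {v \<in> V. y v \<le> \<eta>}"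
        then have "y v \<le> \<eta>" by simp
        then have "reach_prob {v} w \<noteq> 0" "d v / reach_prob {v} w \<le> \<eta>" using \<eta> by (auto simp: y_def split: if_splits)
        then show "reach_prob (insert v S) w - reach_prob S w \<le> \<eta> * reach_prob {v} w"
          using reach_prob_nonneg [of "{v}" w] by (simp add: d_def pos_divide_le_eq)
      qed
      finally show "sum Y {v \<in> V. y v \<le> \<eta>} \<le> reach_prob S w / (1 - sqrt \<eta>)" .
    qed
    fix v assume v: "v \<in> V"
    have *: "Y v \<le> seed_prob \<pi> v * reach_prob {v} w" unfolding Y_def by (rule expect_first_reach_le [OF v w])
    have x0: "0 \<le> seed_prob \<pi> v" unfolding seed_prob_def by (rule E_nonneg) simp
    show "Y v * y v \<le> seed_prob \<pi> v * d v"
    proof (cases "reach_prob {v} w = 0")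
      case True
      then have "Y v = 0" using * Y0 [of v] by simp
      then show ?thesis using x0 d0 by simp
    next
      case False
      have "Y v * y v \<le> seed_prob \<pi> v * reach_prob {v} w * y v" by (rule mult_right_mono [OF * y0])
      also have "\<dots> = seed_prob \<pi> v * d v" using False by (simp add: y_def)
      finally show ?thesis .
    qed
  qed simp
  finally show ?thesis by (simp add: d_def algebra_simps)
qed

lemma sigma_eq_sum_reach_prob: "sigma V E p S = (\<Sum>w\<in>V. reach_prob S w)"
proof -
  have "real (card (Gamma V S \<phi>)) = (\<Sum>w\<in>V. of_bool (w \<in> Gamma V S \<phi>))" for \<phi>
    using finite_V by (simp add: of_bool_def sum.If_cases Gamma_def Int_def)
  then show ?thesis
    unfolding reach_prob_def expect_sum [symmetric] by (simp add: sigma_def expect_def real_prob_def)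
qed

lemma sigma_policy_bound:
  assumes \<pi>: "\<pi> \<in> policies_le V E k"
  shows "sigma_policy V E p \<pi> \<le> 184 / 81 * sigma V E p S
    + 16 / 9 * (\<Sum>v\<in>V. seed_prob \<pi> v * (sigma V E p (insert v S) - sigma V E p S))"
proof -
  have "real (card (Gamma V T \<phi>)) = (\<Sum>w\<in>V. of_bool (w \<in> Gamma V T \<phi>))" for \<phi> T
    using finite_V by (simp add: of_bool_def sum.If_cases Gamma_def Int_def)
  then have "sigma_policy V E p \<pi> = (\<Sum>w\<in>V. \<E> (\<lambda>\<phi>. of_bool (w \<in> Gamma V (policy_seeds V E \<pi> \<phi>) \<phi>)))"
    unfolding expect_sum [symmetric] by (simp add: sigma_policy_def expect_def real_prob_def)
  also have "\<dots> \<le> (\<Sum>w\<in>V. 184 / 81 * reach_prob S w + 16 / 9 * (\<Sum>v\<in>V. seed_prob \<pi> v * (reach_prob (insert v S) w - reach_prob S w)))"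
    by (rule sum_mono) (rule policy_node_bound [OF \<pi>])
  also have "\<dots> = 184 / 81 * sigma V E p S + 16 / 9 * (\<Sum>w\<in>V. \<Sum>v\<in>V. seed_prob \<pi> v * (reach_prob (insert v S) w - reach_prob S w))"
    by (simp add: sigma_eq_sum_reach_prob sum.distrib sum_distrib_left)
  also have "(\<Sum>w\<in>V. \<Sum>v\<in>V. seed_prob \<pi> v * (reach_prob (insert v S) w - reach_prob S w))
      = (\<Sum>v\<in>V. seed_prob \<pi> v * (sigma V E p (insert v S) - sigma V E p S))"
    by (subst sum.swap) (simp add: sigma_eq_sum_reach_prob sum_distrib_left sum_subtractf right_diff_distrib)
  finally show ?thesis .
qed

lemma sum_seed_prob_le:
  assumes "\<pi> \<in> policies_le V E k"
  shows "(\<Sum>v\<in>V. seed_prob \<pi> v) \<le> k"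
proof -
  have "(\<Sum>v\<in>V. seed_prob \<pi> v) = \<E> (\<lambda>\<phi>. \<Sum>v\<in>V. of_bool (v \<in> policy_seeds V E \<pi> \<phi>))"
    by (simp add: seed_prob_def expect_sum)
  also have "\<dots> \<le> \<E> (\<lambda>_. real k)"
  proof (rule E_mono)
    fix \<phi> assume "\<phi> \<subseteq> E"
    then have "policy_seeds V E \<pi> \<phi> \<subseteq> V" "card (policy_seeds V E \<pi> \<phi>) \<le> k"
      using assms by (auto simp: policies_le_def)
    then show "(\<Sum>v\<in>V. of_bool (v \<in> policy_seeds V E \<pi> \<phi>)) \<le> real k"
      using finite_V by (simp add: of_bool_def sum.If_cases Int_absorb1)
  qed
  finally show ?thesis by (simp add: expect_const finite_E)
qed

lemma greedy_step:
  assumes \<pi>: "\<pi> \<in> policies_le V E k" and "1 \<le> k"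
  obtains v where "v \<in> V" and
    "sigma_policy V E p \<pi> - 184 / 81 * sigma V E p (insert v S)
      \<le> (1 - 23 / 18 / k) * (sigma_policy V E p \<pi> - 184 / 81 * sigma V E p S)"
proof -
  define \<Delta> where "\<Delta> v = sigma V E p (insert v S) - sigma V E p S" for v
  obtain v where v: "v \<in> V" "\<And>u. u \<in> V \<Longrightarrow> \<Delta> u \<le> \<Delta> v"
  proof -
    have "Max (\<Delta> ` V) \<in> \<Delta> ` V" using finite_V r_in_V by (intro Max_in) auto
    then obtain v where "v \<in> V" "\<Delta> v = Max (\<Delta> ` V)" by force
    then show ?thesis using finite_V that by simp
  qed
  have \<Delta>0: "0 \<le> \<Delta> v"
    unfolding \<Delta>_def sigma_eq_sum_reach_prob by (simp add: sum_mono reach_prob_mono subset_insertI)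
  have "(\<Sum>u\<in>V. seed_prob \<pi> u * \<Delta> u) \<le> (\<Sum>u\<in>V. seed_prob \<pi> u * \<Delta> v)"
    using v(2) by (intro sum_mono mult_left_mono) (auto simp: seed_prob_def intro!: E_nonneg)
  also have "\<dots> \<le> k * \<Delta> v"
    unfolding sum_distrib_right [symmetric] using sum_seed_prob_le [OF \<pi>] \<Delta>0 by (rule mult_right_mono)
  finally have "sigma_policy V E p \<pi> - 184 / 81 * sigma V E p S \<le> 16 / 9 * (k * \<Delta> v)"
    using sigma_policy_bound [OF \<pi>, of S] by (simp add: \<Delta>_def)
  then have "23 / 18 / k * (sigma_policy V E p \<pi> - 184 / 81 * sigma V E p S) \<le> 23 / 18 / k * (16 / 9 * (k * \<Delta> v))"
    by (intro mult_left_mono) auto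
  also have "\<dots> = 184 / 81 * \<Delta> v" using assms(2) by simp
  finally have "sigma_policy V E p \<pi> - 184 / 81 * sigma V E p (insert v S)
      \<le> (1 - 23 / 18 / k) * (sigma_policy V E p \<pi> - 184 / 81 * sigma V E p S)"
    unfolding left_diff_distrib mult_1_left \<Delta>_def by argo
  with v(1) show ?thesis by (rule that)
qed

lemma greedy_bound:
  assumes \<pi>: "\<pi> \<in> policies_le V E k" and k: "1 \<le> k"
  obtains S where "S \<subseteq> V" "card S \<le> k"
    "sigma_policy V E p \<pi> - 184 / 81 * sigma V E p S \<le> exp (- 23 / 18) * sigma_policy V E p \<pi>"
proof -
  let ?B = "sigma_policy V E p \<pi>"
  let ?q = "1 - 23 / 18 / real k"
  have B0: "0 \<le> ?B"
    using E_nonneg [of "\<lambda>\<phi>. real (card (Gamma V (policy_seeds V E \<pi> \<phi>) \<phi>))"]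
    by (simp add: sigma_policy_def expect_def real_prob_def)
  have empty: "sigma V E p {} = 0" by (simp add: sigma_eq_sum_reach_prob reach_prob_empty)
  have "\<exists>S\<subseteq>V. card S \<le> k \<and> ?B - 184 / 81 * sigma V E p S \<le> ?q ^ k * ?B"
  proof (cases "k = 1")
    case True
    obtain v where "v \<in> V" "?B - 184 / 81 * sigma V E p {v} \<le> ?q * (?B - 184 / 81 * sigma V E p {})"
      by (rule greedy_step [OF \<pi> k])
    with True empty show ?thesis by (intro exI [of _ "{v}"]) auto
  next
    case False
    with k have "2 \<le> real k" by simp
    then have "23 / 18 / real k \<le> 23 / 18 / 2" by (intro divide_left_mono) auto
    then have q0: "0 \<le> ?q" by simp
    have "\<exists>S\<subseteq>V. card S \<le> i \<and> ?B - 184 / 81 * sigma V E p S \<le> ?q ^ i * ?B" for i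
    proof (induction i)
      case 0
      then show ?case using empty by auto
    next
      case (Suc i)
      then obtain S where S: "S \<subseteq> V" "card S \<le> i" "?B - 184 / 81 * sigma V E p S \<le> ?q ^ i * ?B" by blast
      obtain v where v: "v \<in> V" "?B - 184 / 81 * sigma V E p (insert v S) \<le> ?q * (?B - 184 / 81 * sigma V E p S)"
        by (rule greedy_step [OF \<pi> k])
      note v(2)
      also have "?q * (?B - 184 / 81 * sigma V E p S) \<le> ?q * (?q ^ i * ?B)"
        by (rule mult_left_mono [OF S(3) q0])
      finally have "?B - 184 / 81 * sigma V E p (insert v S) \<le> ?q ^ Suc i * ?B" by simp
      moreover have "card (insert v S) \<le> Suc i" using S(2) card_insert_le_m1 [of "Suc i" S v] by simp
      ultimately show ?case using S(1) v(1) by (intro exI [of _ "insert v S"]) simp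
    qed
    then show ?thesis .
  qed
  then obtain S where S: "S \<subseteq> V" "card S \<le> k" "?B - 184 / 81 * sigma V E p S \<le> ?q ^ k * ?B" by blast
  have "?q ^ k \<le> exp (- 23 / 18)"
  proof (cases "k = 1")
    case True
    then show ?thesis using exp_ge_add_one_self [of "- 23 / 18"] by simp
  next
    case False
    with k have "2 \<le> real k" by simp
    then have "23 / 18 / real k \<le> 23 / 18 / 2" by (intro divide_left_mono) auto
    then have "?q ^ k \<le> exp (- (23 / 18 / real k)) ^ k"
      using exp_ge_add_one_self [of "- (23 / 18 / real k)"] by (intro power_mono) auto
    also have "\<dots> = exp (- 23 / 18)" using k by (simp add: exp_of_nat_mult [symmetric])
    finally show ?thesis .
  qed
  then have "?q ^ k * ?B \<le> exp (- 23 / 18) * ?B" using B0 by (rule mult_right_mono)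
  with S show ?thesis by (intro that [of S]) auto
qed

end

theorem theorem1:
  fixes V :: "'a set" and E :: "('a \<times> 'a) set" and p :: "'a \<times> 'a \<Rightarrow> real"
    and r :: 'a and k :: nat
  assumes "influence_graph V E p"
    and "in_arborescence V E r"
    and "k \<ge> 1"
  shows "OPT_A V E p k / OPT_N V E p k \<le> 2 * exp 1 / (exp 1 - 1)"
proof -
  interpret in_tree V E p r using assms by unfold_locales
  let ?C = "2 * exp 1 / (exp 1 - 1) :: real"
  let ?N = "{sigma V E p S | S. S \<subseteq> V \<and> card S \<le> k}"
  have "?N \<subseteq> sigma V E p ` Pow V" by auto
  then have fin: "finite ?N" by (rule finite_subset) (simp add: finite_V)
  have le_OPT_N: "sigma V E p S \<le> OPT_N V E p k" if "S \<subseteq> V" "card S \<le> k" for S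
    unfolding OPT_N_def using that fin by (intro Max_ge) auto
  have "reach_prob {r} r \<le> (\<Sum>w\<in>V. reach_prob {r} w)"
    using finite_V r_in_V reach_prob_nonneg by (intro member_le_sum) auto
  then have "0 < sigma V E p {r}" using reach_prob_self [of r] r_in_V by (simp add: sigma_eq_sum_reach_prob)
  then have N0: "0 < OPT_N V E p k" using le_OPT_N [of "{r}"] r_in_V assms(3) by simp
  have "sigma_policy V E p \<pi> \<le> ?C * OPT_N V E p k" if \<pi>: "\<pi> \<in> policies_le V E k" for \<pi>
  proof -
    obtain S where S: "S \<subseteq> V" "card S \<le> k"
      "sigma_policy V E p \<pi> - 184 / 81 * sigma V E p S \<le> exp (- 23 / 18) * sigma_policy V E p \<pi>"
      by (rule greedy_bound [OF \<pi> assms(3)])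
    have "0 < 1 - exp (- 23 / 18 :: real)" by simp
    moreover have "sigma_policy V E p \<pi> * (1 - exp (- 23 / 18)) \<le> 184 / 81 * OPT_N V E p k"
      using S le_OPT_N [OF S(1,2)] by (simp add: algebra_simps)
    ultimately have "sigma_policy V E p \<pi> \<le> 184 / 81 * OPT_N V E p k / (1 - exp (- 23 / 18))"
      by (rule pos_le_divide_eq [THEN iffD2])
    also have "\<dots> = 184 / 81 / (1 - exp (- 23 / 18)) * OPT_N V E p k" by simp
    also have "\<dots> \<le> ?C * OPT_N V E p k"
      using numeric_ratio N0 by (intro mult_right_mono) auto
    finally show ?thesis .
  qed
  moreover have "policy_seeds V E (\<lambda>_ _ _. None) \<phi> = {}" for \<phi>
  proof -
    have "run_policy V E (\<lambda>_ _ _. None) \<phi> n = []" for n by (induction n) (auto simp: run_policy.simps(2) Let_def)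
    then show ?thesis by (simp add: policy_seeds_def)
  qed
  then have "policies_le V E k \<noteq> {}" by (auto simp: policies_le_def intro!: exI [of _ "\<lambda>_ _ _. None"])
  ultimately have "OPT_A V E p k \<le> ?C * OPT_N V E p k"
    unfolding OPT_A_def by (intro cSup_least) auto
  then show ?thesis using N0 by (simp add: pos_divide_le_eq)
qed

end
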